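(* Let $A$ be a differential ring. Then $$\mathscr{O}_{\mathrm{diff\text{-}Spec}\,A}^{\mathrm{(Keigher)}}\simeq \mathscr{O}_{\mathrm{diff\text{-}Spec}\,A}^{\mathrm{(Kov)}}.$$
   Context: A differential ring is a commutative ring with unit equipped with a derivation. $\mathrm{diff\text{-}Spec}\,A\subset\mathrm{Spec}\,A$ is the set of prime ideals of $A$ stable under the derivation, with the topology induced by the Zariski topology. The derivation of $A$ induces derivations on all localizations of $A$ and on the structure sheaf $\mathscr{O}_{\mathrm{Spec}\,A}$. The Keigher sheaf $\mathscr{O}_{\mathrm{diff\text{-}Spec}\,A}^{\mathrm{(Keigher)}}$ is the restriction $i^{-1}\mathscr{O}_{\mathrm{Spec}\,A}$, $i:\mathrm{diff\text{-}Spec}\,A\to\mathrm{Spec}\,A$ being the inclusion; that is, the sheaf associated to the presheaf $U\mapsto\varinjlim_{V\supset U,\ V\text{ open in }\mathrm{Spec}\,A}\mathscr{O}_{\mathrm{Spec}\,A}(V)$. The Kovacic sheaf: for $U$ open in $\mathrm{diff\text{-}Spec}\,A$, $\mathscr{O}_{\mathrm{diff\text{-}Spec}\,A}^{\mathrm{(Kov)}}(U)$ is the set of maps $s:U\to\coprod_{\mathfrak{p}\in U}A_{\mathfrak{p}}$ such that (i) $s(\mathfrak{p})\in A_{\mathfrak{p}}$ for all $\mathfrak{p}\in U$; (ii) there exist an open covering $(U_i)_{i\in I}$ of $U$ and families $(a_i)_{i\in I},(b_i)_{i\in I}$ of elements of $A$ such that for all $i\in I$ and all $\mathfrak{p}\in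 U_i$, $b_i\notin\mathfrak{p}$ and $s(\mathfrak{p})=\frac{a_i}{b_i}$ in $A_{\mathfrak{p}}$. Operations (including the derivation) are pointwise. Both are sheaves of differential rings, and $\simeq$ denotes isomorphism of such sheaves. *)

theory Defs
  imports "HOL-Algebra.Ideal" "HOL-Analysis.Abstract_Topology"
begin

section \<open>Differential rings\<close>

record 'a diff_ring = "'a ring" +
  der :: "'a \<Rightarrow> 'a" ("\<partial>\<index> _" [81] 80)

text \<open>The zero ring is a differential ring.\<close>

locale diff_ring = cring R for R :: "('a, 'm) diff_ring_scheme" (structure) +
  assumes der_closed: "x \<in> carrier R \<Longrightarrow> der R x \<in> carrier R"
    and der_add: "\<lbrakk>x \<in> carrier R; y \<in> carrier R\<rbrakk> \<Longrightarrow> der R (x \<oplus> y) = der R x \<oplus> der R y"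
    and der_mult: "\<lbrakk>x \<in> carrier R; y \<in> carrier R\<rbrakk> \<Longrightarrow>
          der R (x \<otimes> y) = (der R x \<otimes> y) \<oplus> (x \<otimes> der R y)"

definition diff_ring_hom ::
    "('a, 'm) diff_ring_scheme \<Rightarrow> ('b, 'n) diff_ring_scheme \<Rightarrow> ('a \<Rightarrow> 'b) set" where
  "diff_ring_hom R S = {h \<in> ring_hom R S. \<forall>x\<in>carrier R. h (der R x) = der S (h x)}"

section \<open>Prime spectrum and differential spectrum\<close>

definition primes :: "('a, 'm) ring_scheme \<Rightarrow> 'a set set" where
  "primes R = {P. primeideal P R}"

definition diff_primes :: "('a, 'm) diff_ring_scheme \<Rightarrow> 'a set set" where
  "diff_primes R = {P \<in> primes R. \<forall>x\<in>P. der R x \<in> P}"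

text \<open>The closed sets are the \<open>V(E) = {P. E \<subseteq> P}\<close> for arbitrary subsets \<open>E\<close> of the ring.\<close>

definition zariski :: "('a, 'm) ring_scheme \<Rightarrow> 'a set topology" where
  "zariski R = topology (\<lambda>U. \<exists>E\<subseteq>carrier R. U = {P \<in> primes R. \<not> E \<subseteq> P})"

definition zariski_diff :: "('a, 'm) diff_ring_scheme \<Rightarrow> 'a set topology" where
  "zariski_diff R = subtopology (zariski R) (diff_primes R)"

lemma istopology_zariski: "istopology (\<lambda>U. \<exists>E\<subseteq>carrier R. U = {P \<in> primes R. \<not> E \<subseteq> P})"
proof -
  have inter: "\<exists>G\<subseteq>carrier R. {P \<in> primes R. \<not> E \<subseteq> P} \<inter> {P \<in> primes R. \<not> F \<subseteq> P}
                 = {P \<in> primes R. \<not> G \<subseteq> P}"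
    if EF: "E \<subseteq> carrier R" "F \<subseteq> carrier R" for E F
  proof (cases "primes R = {}")
    case True
    then show ?thesis by auto
  next
    case False
    then obtain P0 where "primeideal P0 R" by (auto simp: primes_def)
    then interpret R: cring R by (simp add: primeideal_def)
    let ?G = "{x \<otimes>\<^bsub>R\<^esub> y | x y. x \<in> E \<and> y \<in> F}"
    have prod: "x \<otimes>\<^bsub>R\<^esub> y \<in> P \<longleftrightarrow> x \<in> P \<or> y \<in> P"
      if "primeideal P R" "x \<in> carrier R" "y \<in> carrier R" for P x y
    proof -
      interpret P: primeideal P R by fact
      show ?thesis
        using that P.I_prime[of x y] P.I_l_closed[of y x] P.I_r_closed[of x y] by auto
    qed
    show ?thesis
    proof (intro exI[of _ ?G] conjI)
      show "?G \<subseteq> carrier R" using EF by auto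
      have "\<not> ?G \<subseteq> P \<longleftrightarrow> \<not> E \<subseteq> P \<and> \<not> F \<subseteq> P" if "P \<in> primes R" for P
      proof -
        have P: "primeideal P R" using that by (simp add: primes_def)
        have "?G \<subseteq> P \<longleftrightarrow> (\<forall>x\<in>E. \<forall>y\<in>F. x \<otimes>\<^bsub>R\<^esub> y \<in> P)" by blast
        also have "\<dots> \<longleftrightarrow> (\<forall>x\<in>E. \<forall>y\<in>F. x \<in> P \<or> y \<in> P)"
          using prod[OF P] EF by (meson subsetD)
        also have "\<dots> \<longleftrightarrow> E \<subseteq> P \<or> F \<subseteq> P" by (auto simp: subset_iff)
        finally show ?thesis by simp
      qed
      then show "{P \<in> primes R. \<not> E \<subseteq> P} \<inter> {P \<in> primes R. \<not> F \<subseteq> P}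
          = {P \<in> primes R. \<not> ?G \<subseteq> P}" by blast
    qed
  qed
  have union: "\<exists>G\<subseteq>carrier R. \<Union>\<K> = {P \<in> primes R. \<not> G \<subseteq> P}"
    if K: "\<forall>U\<in>\<K>. \<exists>E\<subseteq>carrier R. U = {P \<in> primes R. \<not> E \<subseteq> P}" for \<K>
  proof -
    obtain E where E: "\<And>U. U \<in> \<K> \<Longrightarrow> E U \<subseteq> carrier R \<and> U = {P \<in> primes R. \<not> E U \<subseteq> P}"
      using K by metis
    show ?thesis
    proof (intro exI[of _ "\<Union>U\<in>\<K>. E U"] conjI)
      show "(\<Union>U\<in>\<K>. E U) \<subseteq> carrier R" using E by blast
      show "\<Union>\<K> = {P \<in> primes R. \<not> (\<Union>U\<in>\<K>. E U) \<subseteq> P}"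
      proof (intro equalityI subsetI)
        fix P assume "P \<in> \<Union>\<K>"
        then obtain U where "U \<in> \<K>" "P \<in> U" by blast
        then show "P \<in> {P \<in> primes R. \<not> (\<Union>U\<in>\<K>. E U) \<subseteq> P}" using E by blast
      next
        fix P assume "P \<in> {P \<in> primes R. \<not> (\<Union>U\<in>\<K>. E U) \<subseteq> P}"
        then obtain U where "P \<in> primes R" "U \<in> \<K>" "\<not> E U \<subseteq> P" by blast
        then show "P \<in> \<Union>\<K>" using E by blast
      qed
    qed
  qed
  show ?thesis
    unfolding istopology_def
  proof (intro conjI allI impI)
    fix U V assume "\<exists>E\<subseteq>carrier R. U = {P \<in> primes R. \<not> E \<subseteq> P}"
      and "\<exists>E\<subseteq>carrier R. V = {P \<in> primes R. \<not> E \<subseteq> P}"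
    then show "\<exists>E\<subseteq>carrier R. U \<inter> V = {P \<in> primes R. \<not> E \<subseteq> P}"
      by (elim exE conjE) (simp only: inter)
  qed (rule union)
qed

lemma openin_zariski:
  "openin (zariski R) U \<longleftrightarrow> (\<exists>E\<subseteq>carrier R. U = {P \<in> primes R. \<not> E \<subseteq> P})"
  unfolding zariski_def by (simp add: istopology_zariski)

section \<open>Localizations\<close>

text \<open>The fraction \<open>a/s\<close> is the class of \<open>(a, s)\<close> for the usual equivalence relation on
  \<open>carrier R \<times> S\<close>. An operation on fractions is the union of the classes obtained from all
  representatives; by well-definedness all these classes agree.\<close>

definition frac :: "('a, 'm) ring_scheme \<Rightarrow> 'a set \<Rightarrow> 'a \<Rightarrow> 'a \<Rightarrow> ('a \<times> 'a) set" where
  "frac R S a s = {(b, t). b \<in> carrier R \<and> t \<in> S \<and>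
     (\<exists>u\<in>S. u \<otimes>\<^bsub>R\<^esub> ((a \<otimes>\<^bsub>R\<^esub> t) \<ominus>\<^bsub>R\<^esub> (b \<otimes>\<^bsub>R\<^esub> s)) = \<zero>\<^bsub>R\<^esub>)}"

definition localization :: "('a, 'm) diff_ring_scheme \<Rightarrow> 'a set \<Rightarrow> ('a \<times> 'a) set diff_ring" where
  "localization R S =
    \<lparr>carrier = {frac R S a s | a s. a \<in> carrier R \<and> s \<in> S},
     mult = (\<lambda>X Y. \<Union>(a, s)\<in>X. \<Union>(b, t)\<in>Y. frac R S (a \<otimes>\<^bsub>R\<^esub> b) (s \<otimes>\<^bsub>R\<^esub> t)),
     one = frac R S \<one>\<^bsub>R\<^esub> \<one>\<^bsub>R\<^esub>,
     zero = frac R S \<zero>\<^bsub>R\<^esub> \<one>\<^bsub>R\<^esub>,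
     add = (\<lambda>X Y. \<Union>(a, s)\<in>X. \<Union>(b, t)\<in>Y.
       frac R S ((a \<otimes>\<^bsub>R\<^esub> t) \<oplus>\<^bsub>R\<^esub> (b \<otimes>\<^bsub>R\<^esub> s)) (s \<otimes>\<^bsub>R\<^esub> t)),
     der = (\<lambda>X. \<Union>(a, s)\<in>X.
       frac R S ((der R a \<otimes>\<^bsub>R\<^esub> s) \<ominus>\<^bsub>R\<^esub> (a \<otimes>\<^bsub>R\<^esub> der R s)) (s \<otimes>\<^bsub>R\<^esub> s))\<rparr>"

abbreviation local_frac :: "('a, 'm) ring_scheme \<Rightarrow> 'a set \<Rightarrow> 'a \<Rightarrow> 'a \<Rightarrow> ('a \<times> 'a) set" where
  "local_frac R P a b \<equiv> frac R (carrier R - P) a b"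

definition localization_at :: "('a, 'm) diff_ring_scheme \<Rightarrow> 'a set \<Rightarrow> ('a \<times> 'a) set diff_ring" where
  "localization_at R P = localization R (carrier R - P)"

section \<open>Presheaves and sheaves of differential rings\<close>

text \<open>\<open>restr F U V\<close> is the restriction map from the sections over \<open>U\<close> to those over
  \<open>V \<subseteq> U\<close>; both fields are only meaningful on open sets.\<close>

record ('p, 's) presheaf =
  sections :: "'p set \<Rightarrow> 's diff_ring"
  restr :: "'p set \<Rightarrow> 'p set \<Rightarrow> 's \<Rightarrow> 's"

locale diff_ring_presheaf =
  fixes X :: "'p topology" and F :: "('p, 's) presheaf"
  assumes sections_diff_ring: "openin X U \<Longrightarrow> diff_ring (sections F U)"
    and restr_hom: "\<lbrakk>openin X U; openin X V; V \<subseteq> U\<rbrakk> \<Longrightarrow>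
          restr F U V \<in> diff_ring_hom (sections F U) (sections F V)"
    and restr_id: "\<lbrakk>openin X U; s \<in> carrier (sections F U)\<rbrakk> \<Longrightarrow> restr F U U s = s"
    and restr_comp: "\<lbrakk>openin X U; openin X V; openin X W; W \<subseteq> V; V \<subseteq> U;
          s \<in> carrier (sections F U)\<rbrakk> \<Longrightarrow> restr F V W (restr F U V s) = restr F U W s"

locale diff_ring_sheaf = diff_ring_presheaf +
  assumes locality:
      "\<lbrakk>openin X U; \<And>V. V \<in> C \<Longrightarrow> openin X V; \<Union>C = U;
        s \<in> carrier (sections F U); t \<in> carrier (sections F U);
        \<And>V. V \<in> C \<Longrightarrow> restr F U V s = restr F U V t\<rbrakk> \<Longrightarrow> s = t"
    and glueing:
      "\<lbrakk>openin X U; \<And>V. V \<in> C \<Longrightarrow> openin X V; \<Union>C = U;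
        \<And>V. V \<in> C \<Longrightarrow> \<sigma> V \<in> carrier (sections F V);
        \<And>V W. \<lbrakk>V \<in> C; W \<in> C\<rbrakk> \<Longrightarrow> restr F V (V \<inter> W) (\<sigma> V) = restr F W (V \<inter> W) (\<sigma> W)\<rbrakk>
       \<Longrightarrow> \<exists>s\<in>carrier (sections F U). \<forall>V\<in>C. restr F U V s = \<sigma> V"

definition isomorphic_diff_ring_sheaves ::
    "'p topology \<Rightarrow> ('p, 's) presheaf \<Rightarrow> ('p, 't) presheaf \<Rightarrow> bool" where
  "isomorphic_diff_ring_sheaves X F G \<longleftrightarrow>
     diff_ring_sheaf X F \<and> diff_ring_sheaf X G \<and>
     (\<exists>\<phi>. (\<forall>U. openin X U \<longrightarrow>
              \<phi> U \<in> diff_ring_hom (sections F U) (sections G U) \<and>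
              bij_betw (\<phi> U) (carrier (sections F U)) (carrier (sections G U))) \<and>
          (\<forall>U V. openin X U \<and> openin X V \<and> V \<subseteq> U \<longrightarrow>
              (\<forall>s\<in>carrier (sections F U). \<phi> V (restr F U V s) = restr G U V (\<phi> U s))))"

section \<open>Direct limits over open sets, stalks, associated sheaf\<close>

text \<open>\<open>N\<close> is a nonempty set of open sets closed under binary intersections. \<open>germ F N V s\<close>
  is the class of \<open>(V, s)\<close> in the direct limit of the \<open>sections F V\<close>, \<open>V \<in> N\<close>, and operations
  on classes are again unions over all representatives.\<close>

definition germ ::
    "('p, 's) presheaf \<Rightarrow> 'p set set \<Rightarrow> 'p set \<Rightarrow> 's \<Rightarrow> ('p set \<times> 's) set" where
  "germ F N V s = {(V', s'). V' \<in> N \<and> s' \<in> carrier (sections F V') \<and>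
     (\<exists>W\<in>N. W \<subseteq> V \<inter> V' \<and> restr F V W s = restr F V' W s')}"

definition direct_limit ::
    "('p, 's) presheaf \<Rightarrow> 'p set set \<Rightarrow> ('p set \<times> 's) set diff_ring" where
  "direct_limit F N =
    \<lparr>carrier = {germ F N V s | V s. V \<in> N \<and> s \<in> carrier (sections F V)},
     mult = (\<lambda>\<xi> \<eta>. \<Union>(V, s)\<in>\<xi>. \<Union>(W, t)\<in>\<eta>. germ F N (V \<inter> W)
       (restr F V (V \<inter> W) s \<otimes>\<^bsub>sections F (V \<inter> W)\<^esub> restr F W (V \<inter> W) t)),
     one = (\<Union>V\<in>N. germ F N V \<one>\<^bsub>sections F V\<^esub>),
     zero = (\<Union>V\<in>N. germ F N V \<zero>\<^bsub>sections F V\<^esub>),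
     add = (\<lambda>\<xi> \<eta>. \<Union>(V, s)\<in>\<xi>. \<Union>(W, t)\<in>\<eta>. germ F N (V \<inter> W)
       (restr F V (V \<inter> W) s \<oplus>\<^bsub>sections F (V \<inter> W)\<^esub> restr F W (V \<inter> W) t)),
     der = (\<lambda>\<xi>. \<Union>(V, s)\<in>\<xi>. germ F N V (der (sections F V) s))\<rparr>"

abbreviation nhds_of :: "'p topology \<Rightarrow> 'p \<Rightarrow> 'p set set" where
  "nhds_of X p \<equiv> {V. openin X V \<and> p \<in> V}"

definition stalk :: "'p topology \<Rightarrow> ('p, 's) presheaf \<Rightarrow> 'p \<Rightarrow> ('p set \<times> 's) set diff_ring" where
  "stalk X F p = direct_limit F (nhds_of X p)"

text \<open>Functions \<open>U \<rightarrow> \<Coprod>p\<in>U. K p\<close> are rendered as elements of \<open>\<Pi>\<^sub>E p\<in>U. carrier (K p)\<close>.\<close>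

definition pointwise_diff_ring ::
    "'p set \<Rightarrow> ('p \<Rightarrow> 'k diff_ring) \<Rightarrow> ('p \<Rightarrow> 'k) set \<Rightarrow> ('p \<Rightarrow> 'k) diff_ring" where
  "pointwise_diff_ring U K S =
    \<lparr>carrier = S,
     mult = (\<lambda>s t. \<lambda>p\<in>U. s p \<otimes>\<^bsub>K p\<^esub> t p),
     one = (\<lambda>p\<in>U. \<one>\<^bsub>K p\<^esub>),
     zero = (\<lambda>p\<in>U. \<zero>\<^bsub>K p\<^esub>),
     add = (\<lambda>s t. \<lambda>p\<in>U. s p \<oplus>\<^bsub>K p\<^esub> t p),
     der = (\<lambda>s. \<lambda>p\<in>U. der (K p) (s p))\<rparr>"

definition sheafify ::
    "'p topology \<Rightarrow> ('p, 's) presheaf \<Rightarrow> ('p, 'p \<Rightarrow> ('p set \<times> 's) set) presheaf" where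
  "sheafify X F =
    \<lparr>sections = (\<lambda>U. pointwise_diff_ring U (stalk X F)
       {s \<in> (\<Pi>\<^sub>E p\<in>U. carrier (stalk X F p)).
          \<forall>p\<in>U. \<exists>V. openin X V \<and> p \<in> V \<and> V \<subseteq> U \<and>
            (\<exists>t\<in>carrier (sections F V). \<forall>q\<in>V. s q = germ F (nhds_of X q) V t)}),
     restr = (\<lambda>U V s. restrict s V)\<rparr>"

text \<open>Inverse image along the inclusion of a subspace.\<close>

definition presheaf_inverse_image ::
    "'p topology \<Rightarrow> ('p, 's) presheaf \<Rightarrow> ('p, ('p set \<times> 's) set) presheaf" where
  "presheaf_inverse_image X F =
    \<lparr>sections = (\<lambda>U. direct_limit F {V. openin X V \<and> U \<subseteq> V}),
     restr = (\<lambda>U U' \<xi>. \<Union>(V, s)\<in>\<xi>. germ F {V. openin X V \<and> U' \<subseteq> V} V s)\<rparr>"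

definition inverse_image ::
    "'p topology \<Rightarrow> 'p set \<Rightarrow> ('p, 's) presheaf \<Rightarrow>
      ('p, 'p \<Rightarrow> ('p set \<times> ('p set \<times> 's) set) set) presheaf" where
  "inverse_image X Y F = sheafify (subtopology X Y) (presheaf_inverse_image X F)"

section \<open>The structure sheaf and the sheaves of Keigher and Kovacic\<close>

text \<open>Sections given locally by fractions, over the open sets of a space \<open>X\<close> of primes. The
  set \<open>C\<close> consists of the triples \<open>(U\<^sub>i, a\<^sub>i, b\<^sub>i)\<close> of a family indexed by \<open>i\<close>.\<close>

definition fraction_sheaf ::
    "('a, 'm) diff_ring_scheme \<Rightarrow> 'a set topology \<Rightarrow> ('a set, 'a set \<Rightarrow> ('a \<times> 'a) set) presheaf" where
  "fraction_sheaf R X =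
    \<lparr>sections = (\<lambda>U. pointwise_diff_ring U (localization_at R)
       {s \<in> (\<Pi>\<^sub>E P\<in>U. carrier (localization_at R P)).
          \<exists>C \<subseteq> Collect (openin X) \<times> carrier R \<times> carrier R.
            (\<Union>(V, a, b)\<in>C. V) = U \<and>
            (\<forall>(V, a, b)\<in>C. \<forall>P\<in>V. b \<notin> P \<and> s P = local_frac R P a b)}),
     restr = (\<lambda>U V s. restrict s V)\<rparr>"

definition structure_sheaf ::
    "('a, 'm) diff_ring_scheme \<Rightarrow> ('a set, 'a set \<Rightarrow> ('a \<times> 'a) set) presheaf" where
  "structure_sheaf R = fraction_sheaf R (zariski R)"

definition kovacic_sheaf ::
    "('a, 'm) diff_ring_scheme \<Rightarrow> ('a set, 'a set \<Rightarrow> ('a \<times> 'a) set) presheaf" where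
  "kovacic_sheaf R = fraction_sheaf R (zariski_diff R)"

definition keigher_sheaf ::
    "('a, 'm) diff_ring_scheme \<Rightarrow> ('a set, 'a set \<Rightarrow>
      ('a set set \<times> ('a set set \<times> ('a set \<Rightarrow> ('a \<times> 'a) set)) set) set) presheaf" where
  "keigher_sheaf R = inverse_image (zariski R) (diff_primes R) (structure_sheaf R)"

end

theory Submission
  imports Defs
begin

text \<open>
  Both sheaves consist of functions that are locally fractions \<open>a/b\<close>; only the ways in which they
  say so differ. The proof makes this literal by evaluating germs.

  Write \<open>O\<close> for the structure sheaf and \<open>L\<close> for the presheaf \<open>U \<mapsto> colim O(V)\<close> over the Zariski
  neighbourhoods \<open>V\<close> of \<open>U \<subseteq> diff-Spec A\<close>, whose associated sheaf is Keigher's. If two sections of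
  \<open>O\<close> have the same value at a prime \<open>P\<close>, then they agree in a neighbourhood of \<open>P\<close> (\<open>eq_near\<close>):
  an equality \<open>a/b = c/d\<close> in the local ring at \<open>P\<close> is witnessed by some \<open>u \<notin> P\<close>, and the same \<open>u\<close>
  witnesses it at all primes in the basic open set of \<open>u\<close>. This has two consequences.

  First, an element of \<open>L(U)\<close> is determined by its values at the points of \<open>U\<close>, because the union of
  the neighbourhoods on which two representatives agree is again a neighbourhood of \<open>U\<close>. Hence \<open>L(U)\<close>
  is the differential ring of those functions on \<open>U\<close> that extend to a section of \<open>O\<close> near \<open>U\<close>
  (\<open>trace_transport\<close>). Second, evaluation at \<open>q\<close> identifies the stalk of \<open>L\<close> at \<open>q\<close> with the local
  ring at \<open>q\<close> (\<open>stalk_transport\<close>). Both are instances of one description of a direct limit by a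
  compatible family of maps into a given ring (\<open>direct_limit_transport\<close>).

  Applying the isomorphisms of stalks pointwise turns families of germs into functions with values in
  the local rings. A family that is locally the germ of an element of \<open>L\<close> becomes a function that is
  locally a fraction. Conversely, a fraction \<open>a/b\<close> that makes sense on \<open>V \<subseteq> diff-Spec A\<close> makes sense
  on the Zariski open set of all primes not containing \<open>b\<close>, hence comes from an element of \<open>L(V)\<close>
  (\<open>locally_germ_iff_locally_fraction\<close>). So the sections of the two sheaves correspond.

  Direct limits, stalks and Keigher's sheaf are not shown to be differential rings by verifying the
  axioms on classes. They are put in bijection, compatibly with the operations, with something known to
  be a differential ring, and the axioms are pulled back (\<open>diff_ring_source\<close>, \<open>sheaf_transport\<close>). Only
  the localizations and certain rings of functions are treated directly.
\<close>

section \<open>Localizations of differential rings\<close>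

text \<open>Operations on classes are unions over all representatives. When the result does not depend on
  the representatives, any one of them computes the union.\<close>
lemma UN_pair_eq:
  assumes "(x, y) \<in> A" "\<And>x y. (x, y) \<in> A \<Longrightarrow> f x y = c"
  shows "(\<Union>(x, y)\<in>A. f x y) = c"
  using assms by fast

context cring
begin

text \<open>Equations between differences are reduced to equations between sums. The latter hold without
  cancellation in the cases below, so that rewriting modulo associativity, commutativity and
  distributivity decides them.\<close>
lemma diff_eqI:
  assumes "x \<oplus> w = z \<oplus> y" and [simp]: "x \<in> carrier R" "y \<in> carrier R" "z \<in> carrier R" "w \<in> carrier R"
  shows "x \<ominus> y = z \<ominus> w"
proof -
  have "x = (z \<oplus> y) \<oplus> \<ominus> w"
    unfolding assms(1)[symmetric] by (simp add: a_assoc r_neg)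
  then have "x \<ominus> y = y \<oplus> (\<ominus> y \<oplus> (z \<oplus> \<ominus> w))"
    by (simp add: minus_eq a_ac)
  then show ?thesis
    by (simp add: minus_eq r_neg2)
qed

lemma diff_mult_distrib:
  assumes "x \<in> carrier R" "y \<in> carrier R" "z \<in> carrier R"
  shows "(x \<ominus> y) \<otimes> z = x \<otimes> z \<ominus> y \<otimes> z" and "z \<otimes> (x \<ominus> y) = z \<otimes> x \<ominus> z \<otimes> y"
  using assms by (simp_all add: minus_eq l_distr r_distr l_minus r_minus)

lemma diff_add_diff:
  assumes "x \<in> carrier R" "y \<in> carrier R" "z \<in> carrier R" "w \<in> carrier R"
  shows "(x \<ominus> y) \<oplus> (z \<ominus> w) = (x \<oplus> z) \<ominus> (y \<oplus> w)"
  using assms by (simp add: minus_eq minus_add a_ac)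

lemma mult_diff_eq_zero_iff:
  assumes [simp]: "u \<in> carrier R" "x \<in> carrier R" "y \<in> carrier R"
  shows "u \<otimes> (x \<ominus> y) = \<zero> \<longleftrightarrow> u \<otimes> x = u \<otimes> y"
proof
  assume "u \<otimes> (x \<ominus> y) = \<zero>"
  then have "u \<otimes> x \<oplus> \<ominus> (u \<otimes> y) = \<zero>"
    by (simp add: minus_eq r_distr r_minus)
  then show "u \<otimes> x = u \<otimes> y"
    using minus_equality[of "u \<otimes> x" "\<ominus> (u \<otimes> y)"] by simp
next
  assume "u \<otimes> x = u \<otimes> y"
  then show "u \<otimes> (x \<ominus> y) = \<zero>"
    by (simp add: minus_eq r_distr r_minus r_neg)
qed

end

locale localized_diff_ring = diff_ring +
  fixes S :: "'a set"
  assumes subset: "S \<subseteq> carrier R"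
    and one_mem: "\<one> \<in> S"
    and mult_mem: "\<lbrakk>x \<in> S; y \<in> S\<rbrakk> \<Longrightarrow> x \<otimes> y \<in> S"
begin

lemma mem_carrier [simp]: "s \<in> S \<Longrightarrow> s \<in> carrier R"
  using subset by blast

declare one_mem [simp] mult_mem [simp] der_closed [simp]

lemma mem_frac_iff:
  assumes "a \<in> carrier R" "s \<in> S"
  shows "(b, t) \<in> frac R S a s \<longleftrightarrow>
    b \<in> carrier R \<and> t \<in> S \<and> (\<exists>u\<in>S. u \<otimes> (a \<otimes> t) = u \<otimes> (b \<otimes> s))"
  using assms by (auto simp: frac_def mult_diff_eq_zero_iff)

lemma fracI:
  assumes "a \<in> carrier R" "s \<in> S"
  shows "(a, s) \<in> frac R S a s"
  using assms by (auto simp: mem_frac_iff intro!: bexI[of _ \<one>])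

lemma frac_cong:
  assumes abst: "a \<in> carrier R" "b \<in> carrier R" "s \<in> S" "t \<in> S"
    and u: "u \<in> S" "u \<otimes> (a \<otimes> t) = u \<otimes> (b \<otimes> s)"
  shows "frac R S a s = frac R S b t"
proof -
  have sub: "frac R S a s \<subseteq> frac R S b t"
    if [simp]: "a \<in> carrier R" "b \<in> carrier R" "s \<in> S" "t \<in> S" "u \<in> S"
      and u: "u \<otimes> (a \<otimes> t) = u \<otimes> (b \<otimes> s)" for a b s t u
  proof (rule subrelI)
    fix c r assume "(c, r) \<in> frac R S a s"
    then obtain v where [simp]: "c \<in> carrier R" "r \<in> S" "v \<in> S" and v: "v \<otimes> (a \<otimes> r) = v \<otimes> (c \<otimes> s)"
      by (auto simp: mem_frac_iff)
    \<comment> \<open>Transitivity: the two witnesses are multiplied with each other and with the middle denominator.\<close>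
    have "(u \<otimes> v \<otimes> s) \<otimes> (b \<otimes> r) = (v \<otimes> r) \<otimes> (u \<otimes> (b \<otimes> s))"
      by (simp add: m_ac)
    also have "\<dots> = (u \<otimes> t) \<otimes> (v \<otimes> (a \<otimes> r))"
      by (simp add: u[symmetric] m_ac)
    also have "\<dots> = (u \<otimes> v \<otimes> s) \<otimes> (c \<otimes> t)"
      by (simp add: v m_ac)
    finally have "(u \<otimes> v \<otimes> s) \<otimes> (b \<otimes> r) = (u \<otimes> v \<otimes> s) \<otimes> (c \<otimes> t)" .
    moreover have "u \<otimes> v \<otimes> s \<in> S"
      by simp
    ultimately have "\<exists>w\<in>S. w \<otimes> (b \<otimes> r) = w \<otimes> (c \<otimes> t)"
      by blast
    then show "(c, r) \<in> frac R S b t"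
      by (simp add: mem_frac_iff)
  qed
  show ?thesis
    using sub[OF abst u] sub[OF abst(2,1,4,3) u(1) u(2)[symmetric]] by blast
qed

lemma frac_eq_iff:
  assumes "a \<in> carrier R" "b \<in> carrier R" "s \<in> S" "t \<in> S"
  shows "frac R S a s = frac R S b t \<longleftrightarrow> (\<exists>u\<in>S. u \<otimes> (a \<otimes> t) = u \<otimes> (b \<otimes> s))"
proof
  assume "frac R S a s = frac R S b t"
  then have "(b, t) \<in> frac R S a s"
    using fracI assms by simp
  then show "\<exists>u\<in>S. u \<otimes> (a \<otimes> t) = u \<otimes> (b \<otimes> s)"
    using assms by (auto simp: mem_frac_iff)
qed (use assms frac_cong in blast)

lemma frac_eqI:
  assumes "a \<otimes> t = b \<otimes> s" "a \<in> carrier R" "b \<in> carrier R" "s \<in> S" "t \<in> S"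
  shows "frac R S a s = frac R S b t"
  using assms by (intro frac_cong[of _ _ _ _ \<one>]) auto

lemma frac_cancel:
  assumes "a \<in> carrier R" "s \<in> S" "k \<in> S"
  shows "frac R S (a \<otimes> k) (s \<otimes> k) = frac R S a s"
  using assms by (intro frac_eqI) (simp_all add: m_ac)

lemma fracE:
  assumes "(b, t) \<in> frac R S a s" "a \<in> carrier R" "s \<in> S"
  obtains u where "b \<in> carrier R" "t \<in> S" "u \<in> S" "u \<otimes> (a \<otimes> t) = u \<otimes> (b \<otimes> s)"
  using assms by (auto simp: mem_frac_iff)

lemma add_frac:
  assumes [simp]: "a \<in> carrier R" "b \<in> carrier R" "s \<in> S" "t \<in> S"
  shows "frac R S a s \<oplus>\<^bsub>localization R S\<^esub> frac R S b t = frac R S (a \<otimes> t \<oplus> b \<otimes> s) (s \<otimes> t)"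
proof -
  have well_defined: "frac R S (a' \<otimes> t' \<oplus> b' \<otimes> s') (s' \<otimes> t') = frac R S (a \<otimes> t \<oplus> b \<otimes> s) (s \<otimes> t)"
    if a': "(a', s') \<in> frac R S a s" and b': "(b', t') \<in> frac R S b t" for a' s' b' t'
  proof -
    obtain u where [simp]: "a' \<in> carrier R" "s' \<in> S" "u \<in> S" and u: "u \<otimes> (a \<otimes> s') = u \<otimes> (a' \<otimes> s)"
      using a' by (rule fracE) simp_all
    obtain v where [simp]: "b' \<in> carrier R" "t' \<in> S" "v \<in> S" and v: "v \<otimes> (b \<otimes> t') = v \<otimes> (b' \<otimes> t)"
      using b' by (rule fracE) simp_all
    have "(u \<otimes> v) \<otimes> ((a \<otimes> t \<oplus> b \<otimes> s) \<otimes> (s' \<otimes> t'))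
        = (v \<otimes> t \<otimes> t') \<otimes> (u \<otimes> (a \<otimes> s')) \<oplus> (u \<otimes> s \<otimes> s') \<otimes> (v \<otimes> (b \<otimes> t'))"
      by (simp add: l_distr r_distr m_ac)
    also have "\<dots> = (u \<otimes> v) \<otimes> ((a' \<otimes> t' \<oplus> b' \<otimes> s') \<otimes> (s \<otimes> t))"
      unfolding u v by (simp add: l_distr r_distr m_ac)
    finally show ?thesis
      by (intro frac_cong[where u = "u \<otimes> v", symmetric]) simp_all
  qed
  show ?thesis
    unfolding localization_def monoid.simps ring.simps diff_ring.simps
    by (rule UN_pair_eq[OF fracI], simp, simp)+ (rule well_defined)
qed

lemma mult_frac:
  assumes [simp]: "a \<in> carrier R" "b \<in> carrier R" "s \<in> S" "t \<in> S"
  shows "frac R S a s \<otimes>\<^bsub>localization R S\<^esub> frac R S b t = frac R S (a \<otimes> b) (s \<otimes> t)"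
proof -
  have well_defined: "frac R S (a' \<otimes> b') (s' \<otimes> t') = frac R S (a \<otimes> b) (s \<otimes> t)"
    if a': "(a', s') \<in> frac R S a s" and b': "(b', t') \<in> frac R S b t" for a' s' b' t'
  proof -
    obtain u where [simp]: "a' \<in> carrier R" "s' \<in> S" "u \<in> S" and u: "u \<otimes> (a \<otimes> s') = u \<otimes> (a' \<otimes> s)"
      using a' by (rule fracE) simp_all
    obtain v where [simp]: "b' \<in> carrier R" "t' \<in> S" "v \<in> S" and v: "v \<otimes> (b \<otimes> t') = v \<otimes> (b' \<otimes> t)"
      using b' by (rule fracE) simp_all
    have "(u \<otimes> v) \<otimes> ((a \<otimes> b) \<otimes> (s' \<otimes> t')) = (u \<otimes> (a \<otimes> s')) \<otimes> (v \<otimes> (b \<otimes> t'))"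
      by (simp add: m_ac)
    also have "\<dots> = (u \<otimes> v) \<otimes> ((a' \<otimes> b') \<otimes> (s \<otimes> t))"
      unfolding u v by (simp add: m_ac)
    finally show ?thesis
      by (intro frac_cong[where u = "u \<otimes> v", symmetric]) simp_all
  qed
  show ?thesis
    unfolding localization_def monoid.simps ring.simps diff_ring.simps
    by (rule UN_pair_eq[OF fracI], simp, simp)+ (rule well_defined)
qed

text \<open>The quotient rule respects equality of fractions. If \<open>u a t = u b s\<close>, then differentiating and
  multiplying by \<open>u\<close> once more makes the terms with the derivative of \<open>u\<close> cancel, and leaves
  \<open>u\<^sup>2 (a t)' = u\<^sup>2 (b s)'\<close>. So the square of the witness for the fractions is a witness for their
  derivatives.\<close>
lemma der_frac:
  assumes [simp]: "a \<in> carrier R" "s \<in> S"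
  shows "der (localization R S) (frac R S a s) = frac R S (der R a \<otimes> s \<ominus> a \<otimes> der R s) (s \<otimes> s)"
proof -
  have well_defined: "frac R S (der R b \<otimes> t \<ominus> b \<otimes> der R t) (t \<otimes> t)
      = frac R S (der R a \<otimes> s \<ominus> a \<otimes> der R s) (s \<otimes> s)"
    if b: "(b, t) \<in> frac R S a s" for b t
  proof -
    obtain u where [simp]: "b \<in> carrier R" "t \<in> S" "u \<in> S" and u: "u \<otimes> (a \<otimes> t) = u \<otimes> (b \<otimes> s)"
      using b by (rule fracE) simp_all
    let ?X = "der R a \<otimes> t \<oplus> a \<otimes> der R t" and ?Y = "der R b \<otimes> s \<oplus> b \<otimes> der R s"
    have "der R (u \<otimes> (a \<otimes> t)) = der R (u \<otimes> (b \<otimes> s))"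
      by (simp only: u)
    then have "der R u \<otimes> (a \<otimes> t) \<oplus> u \<otimes> ?X = der R u \<otimes> (b \<otimes> s) \<oplus> u \<otimes> ?Y"
      by (simp add: der_mult)
    then have "u \<otimes> (der R u \<otimes> (a \<otimes> t) \<oplus> u \<otimes> ?X) = u \<otimes> (der R u \<otimes> (b \<otimes> s) \<oplus> u \<otimes> ?Y)"
      by (simp only:)
    then have "der R u \<otimes> (u \<otimes> (a \<otimes> t)) \<oplus> u \<otimes> u \<otimes> ?X = der R u \<otimes> (u \<otimes> (b \<otimes> s)) \<oplus> u \<otimes> u \<otimes> ?Y"
      by (simp add: r_distr m_ac)
    then have XY: "u \<otimes> u \<otimes> ?X = u \<otimes> u \<otimes> ?Y"
      unfolding u by simp
    \<comment> \<open>The wanted equality of differences, with the subtracted terms moved to the other side.\<close>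
    have "u \<otimes> u \<otimes> (der R a \<otimes> s \<otimes> (t \<otimes> t)) \<oplus> u \<otimes> u \<otimes> (b \<otimes> der R t \<otimes> (s \<otimes> s))
        = s \<otimes> t \<otimes> (u \<otimes> u \<otimes> (der R a \<otimes> t)) \<oplus> s \<otimes> u \<otimes> der R t \<otimes> (u \<otimes> (b \<otimes> s))"
      by (simp add: m_ac)
    also have "\<dots> = s \<otimes> t \<otimes> (u \<otimes> u \<otimes> ?X)"
      unfolding u[symmetric] by (simp add: r_distr m_ac)
    also have "\<dots> = s \<otimes> t \<otimes> (u \<otimes> u \<otimes> (der R b \<otimes> s)) \<oplus> t \<otimes> u \<otimes> der R s \<otimes> (u \<otimes> (b \<otimes> s))"
      unfolding XY by (simp add: r_distr m_ac)
    also have "\<dots> = u \<otimes> u \<otimes> (der R b \<otimes> t \<otimes> (s \<otimes> s)) \<oplus> u \<otimes> u \<otimes> (a \<otimes> der R s \<otimes> (t \<otimes> t))"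
      unfolding u[symmetric] by (simp add: m_ac)
    finally have "u \<otimes> u \<otimes> (der R a \<otimes> s \<otimes> (t \<otimes> t)) \<ominus> u \<otimes> u \<otimes> (a \<otimes> der R s \<otimes> (t \<otimes> t))
        = u \<otimes> u \<otimes> (der R b \<otimes> t \<otimes> (s \<otimes> s)) \<ominus> u \<otimes> u \<otimes> (b \<otimes> der R t \<otimes> (s \<otimes> s))"
      by (rule diff_eqI) simp_all
    then have "(u \<otimes> u) \<otimes> ((der R a \<otimes> s \<ominus> a \<otimes> der R s) \<otimes> (t \<otimes> t))
        = (u \<otimes> u) \<otimes> ((der R b \<otimes> t \<ominus> b \<otimes> der R t) \<otimes> (s \<otimes> s))"
      by (simp add: diff_mult_distrib)
    then show ?thesis
      by (intro frac_cong[where u = "u \<otimes> u", symmetric]) simp_all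
  qed
  show ?thesis
    unfolding localization_def monoid.simps ring.simps diff_ring.simps
    by (rule UN_pair_eq[OF fracI], simp, simp) (rule well_defined)
qed

lemma carrier_localization: "carrier (localization R S) = {frac R S a s | a s. a \<in> carrier R \<and> s \<in> S}"
  and one_localization: "\<one>\<^bsub>localization R S\<^esub> = frac R S \<one> \<one>"
  and zero_localization: "\<zero>\<^bsub>localization R S\<^esub> = frac R S \<zero> \<one>"
  by (simp_all add: localization_def)

lemma frac_closed:
  "\<lbrakk>a \<in> carrier R; s \<in> S\<rbrakk> \<Longrightarrow> frac R S a s \<in> carrier (localization R S)"
  unfolding carrier_localization by blast

lemma localizationE:
  assumes "X \<in> carrier (localization R S)"
  obtains a s where "X = frac R S a s" "a \<in> carrier R" "s \<in> S"
  using assms unfolding carrier_localization by blast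

lemma add_inverse_frac:
  assumes [simp]: "a \<in> carrier R" "s \<in> S"
  shows "frac R S (\<ominus> a) s \<oplus>\<^bsub>localization R S\<^esub> frac R S a s = \<zero>\<^bsub>localization R S\<^esub>"
  by (simp add: add_frac zero_localization, rule frac_eqI) (simp_all add: l_minus l_neg)

lemma diff_ring_localization: "diff_ring (localization R S)"
proof -
  let ?L = "localization R S"
  note ops = add_frac mult_frac der_frac one_localization zero_localization
  have "abelian_group ?L"
  proof (rule abelian_groupI)
    fix X assume "X \<in> carrier ?L"
    then obtain a s where [simp]: "X = frac R S a s" "a \<in> carrier R" "s \<in> S"
      by (rule localizationE)
    show "\<zero>\<^bsub>?L\<^esub> \<oplus>\<^bsub>?L\<^esub> X = X"
      by (simp add: ops)
    show "\<exists>Y\<in>carrier ?L. Y \<oplus>\<^bsub>?L\<^esub> X = \<zero>\<^bsub>?L\<^esub>"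
      using add_inverse_frac[of a s] frac_closed[of "\<ominus> a" s] by auto
    fix Y assume "Y \<in> carrier ?L"
    then obtain b t where [simp]: "Y = frac R S b t" "b \<in> carrier R" "t \<in> S"
      by (rule localizationE)
    show "X \<oplus>\<^bsub>?L\<^esub> Y \<in> carrier ?L"
      by (simp add: ops frac_closed)
    show "X \<oplus>\<^bsub>?L\<^esub> Y = Y \<oplus>\<^bsub>?L\<^esub> X"
      by (simp add: ops a_comm m_comm)
    fix Z assume "Z \<in> carrier ?L"
    then obtain c r where [simp]: "Z = frac R S c r" "c \<in> carrier R" "r \<in> S"
      by (rule localizationE)
    show "X \<oplus>\<^bsub>?L\<^esub> Y \<oplus>\<^bsub>?L\<^esub> Z = X \<oplus>\<^bsub>?L\<^esub> (Y \<oplus>\<^bsub>?L\<^esub> Z)"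
      by (simp add: ops l_distr r_distr m_ac a_ac)
  qed (simp add: ops frac_closed)
  moreover have "comm_monoid ?L"
  proof (rule comm_monoidI)
    fix X Y assume "X \<in> carrier ?L" "Y \<in> carrier ?L"
    then obtain a s b t where [simp]: "X = frac R S a s" "a \<in> carrier R" "s \<in> S"
      "Y = frac R S b t" "b \<in> carrier R" "t \<in> S"
      by (elim localizationE)
    show "X \<otimes>\<^bsub>?L\<^esub> Y \<in> carrier ?L" "X \<otimes>\<^bsub>?L\<^esub> Y = Y \<otimes>\<^bsub>?L\<^esub> X" "\<one>\<^bsub>?L\<^esub> \<otimes>\<^bsub>?L\<^esub> X = X"
      by (simp_all add: ops frac_closed m_comm)
    fix Z assume "Z \<in> carrier ?L"
    then obtain c r where [simp]: "Z = frac R S c r" "c \<in> carrier R" "r \<in> S"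
      by (rule localizationE)
    show "X \<otimes>\<^bsub>?L\<^esub> Y \<otimes>\<^bsub>?L\<^esub> Z = X \<otimes>\<^bsub>?L\<^esub> (Y \<otimes>\<^bsub>?L\<^esub> Z)"
      by (simp add: ops m_assoc)
  qed (simp add: ops frac_closed)
  moreover have "(X \<oplus>\<^bsub>?L\<^esub> Y) \<otimes>\<^bsub>?L\<^esub> Z = X \<otimes>\<^bsub>?L\<^esub> Z \<oplus>\<^bsub>?L\<^esub> Y \<otimes>\<^bsub>?L\<^esub> Z"
    if XYZ: "X \<in> carrier ?L" "Y \<in> carrier ?L" "Z \<in> carrier ?L" for X Y Z
  proof -
    obtain a s b t c r where [simp]: "X = frac R S a s" "a \<in> carrier R" "s \<in> S"
      "Y = frac R S b t" "b \<in> carrier R" "t \<in> S" "Z = frac R S c r" "c \<in> carrier R" "r \<in> S"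
      using XYZ by (elim localizationE)
    have "a \<otimes> c \<otimes> (t \<otimes> r) \<oplus> b \<otimes> c \<otimes> (s \<otimes> r) = (a \<otimes> t \<oplus> b \<otimes> s) \<otimes> c \<otimes> r"
      by (simp add: l_distr r_distr m_ac)
    moreover have "s \<otimes> r \<otimes> (t \<otimes> r) = s \<otimes> t \<otimes> r \<otimes> r"
      by (simp add: m_ac)
    ultimately show ?thesis
      using frac_cancel[of "(a \<otimes> t \<oplus> b \<otimes> s) \<otimes> c" "s \<otimes> t \<otimes> r" r] by (simp add: ops)
  qed
  ultimately have "cring ?L"
    by (rule cringI)
  then show ?thesis
  proof (rule diff_ring.intro, unfold_locales)
    fix X assume "X \<in> carrier ?L"
    then obtain a s where [simp]: "X = frac R S a s" "a \<in> carrier R" "s \<in> S"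
      by (rule localizationE)
    show "der ?L X \<in> carrier ?L"
      by (simp add: ops frac_closed)
    fix Y assume "Y \<in> carrier ?L"
    then obtain b t where [simp]: "Y = frac R S b t" "b \<in> carrier R" "t \<in> S"
      by (rule localizationE)
    have "der R (a \<otimes> t \<oplus> b \<otimes> s) \<otimes> (s \<otimes> t) \<ominus> (a \<otimes> t \<oplus> b \<otimes> s) \<otimes> der R (s \<otimes> t)
        = (der R a \<otimes> s \<ominus> a \<otimes> der R s) \<otimes> (t \<otimes> t) \<oplus> (der R b \<otimes> t \<ominus> b \<otimes> der R t) \<otimes> (s \<otimes> s)"
      by (simp add: diff_mult_distrib diff_add_diff, rule diff_eqI)
        (simp_all add: der_add der_mult l_distr r_distr m_ac a_ac)
    moreover have "s \<otimes> t \<otimes> (s \<otimes> t) = s \<otimes> s \<otimes> (t \<otimes> t)"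
      by (simp add: m_ac)
    ultimately show "der ?L (X \<oplus>\<^bsub>?L\<^esub> Y) = der ?L X \<oplus>\<^bsub>?L\<^esub> der ?L Y"
      by (simp add: ops)
    \<comment> \<open>The right-hand side of the Leibniz rule has the larger denominator \<open>(s t)\<^sup>3\<close>, so the left-hand
      side is expanded by \<open>s t\<close>.\<close>
    have "(der R (a \<otimes> b) \<otimes> (s \<otimes> t) \<ominus> a \<otimes> b \<otimes> der R (s \<otimes> t)) \<otimes> (s \<otimes> t)
        = (der R a \<otimes> s \<ominus> a \<otimes> der R s) \<otimes> b \<otimes> (s \<otimes> (t \<otimes> t)) \<oplus> a \<otimes> (der R b \<otimes> t \<ominus> b \<otimes> der R t) \<otimes> (s \<otimes> s \<otimes> t)"
      by (simp add: diff_mult_distrib diff_add_diff, rule diff_eqI)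
        (simp_all add: der_mult l_distr r_distr m_ac a_ac)
    moreover have "s \<otimes> t \<otimes> (s \<otimes> t) \<otimes> (s \<otimes> t) = s \<otimes> s \<otimes> t \<otimes> (s \<otimes> (t \<otimes> t))"
      by (simp add: m_ac)
    ultimately show "der ?L (X \<otimes>\<^bsub>?L\<^esub> Y) = der ?L X \<otimes>\<^bsub>?L\<^esub> Y \<oplus>\<^bsub>?L\<^esub> X \<otimes>\<^bsub>?L\<^esub> der ?L Y"
      using frac_cancel[of "der R (a \<otimes> b) \<otimes> (s \<otimes> t) \<ominus> a \<otimes> b \<otimes> der R (s \<otimes> t)" "s \<otimes> t \<otimes> (s \<otimes> t)" "s \<otimes> t"]
      by (simp add: ops)
  qed
qed

lemma a_inv_frac:
  assumes "a \<in> carrier R" "s \<in> S"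
  shows "\<ominus>\<^bsub>localization R S\<^esub> frac R S a s = frac R S (\<ominus> a) s"
proof -
  interpret L: diff_ring "localization R S" by (rule diff_ring_localization)
  show ?thesis
    using assms by (intro L.minus_equality add_inverse_frac frac_closed) simp_all
qed

end

lemma (in diff_ring) localized_at_prime:
  assumes "primeideal P R"
  shows "localized_diff_ring R (carrier R - P)"
proof -
  interpret P: primeideal P R by fact
  show ?thesis
  proof unfold_locales
    show "\<one> \<in> carrier R - P"
      using P.one_imp_carrier P.I_notcarr by auto
    show "x \<otimes> y \<in> carrier R - P" if "x \<in> carrier R - P" "y \<in> carrier R - P" for x y
      using that P.I_prime[of x y] by auto
  qed simp
qed

section \<open>Transport of structure\<close>

lemma diff_ring_hom_closed: "\<lbrakk>h \<in> diff_ring_hom R S; x \<in> carrier R\<rbrakk> \<Longrightarrow> h x \<in> carrier S"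
  by (auto simp: diff_ring_hom_def ring_hom_def)

text \<open>A bijection onto a differential ring along which the operations correspond. The source is a mere
  record that is closed under its operations; this suffices for it to inherit the axioms.\<close>
locale diff_ring_transport =
  S: diff_ring S for R :: "('a, 'm) diff_ring_scheme" and S :: "('b, 'n) diff_ring_scheme"
    and f :: "'a \<Rightarrow> 'b" +
  assumes bij: "bij_betw f (carrier R) (carrier S)"
    and one: "\<one>\<^bsub>R\<^esub> \<in> carrier R" "f \<one>\<^bsub>R\<^esub> = \<one>\<^bsub>S\<^esub>"
    and zero: "\<zero>\<^bsub>R\<^esub> \<in> carrier R" "f \<zero>\<^bsub>R\<^esub> = \<zero>\<^bsub>S\<^esub>"
    and mult: "\<lbrakk>x \<in> carrier R; y \<in> carrier R\<rbrakk> \<Longrightarrow> x \<otimes>\<^bsub>R\<^esub> y \<in> carrier R"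
      "\<lbrakk>x \<in> carrier R; y \<in> carrier R\<rbrakk> \<Longrightarrow> f (x \<otimes>\<^bsub>R\<^esub> y) = f x \<otimes>\<^bsub>S\<^esub> f y"
    and add: "\<lbrakk>x \<in> carrier R; y \<in> carrier R\<rbrakk> \<Longrightarrow> x \<oplus>\<^bsub>R\<^esub> y \<in> carrier R"
      "\<lbrakk>x \<in> carrier R; y \<in> carrier R\<rbrakk> \<Longrightarrow> f (x \<oplus>\<^bsub>R\<^esub> y) = f x \<oplus>\<^bsub>S\<^esub> f y"
    and der: "x \<in> carrier R \<Longrightarrow> der R x \<in> carrier R"
      "x \<in> carrier R \<Longrightarrow> f (der R x) = der S (f x)"
begin

lemma closed: "x \<in> carrier R \<Longrightarrow> f x \<in> carrier S"
  using bij bij_betwE by blast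

lemma eqI: "\<lbrakk>f x = f y; x \<in> carrier R; y \<in> carrier R\<rbrakk> \<Longrightarrow> x = y"
  using bij by (auto simp: bij_betw_def inj_on_def)

lemma surjE:
  assumes "y \<in> carrier S"
  obtains x where "x \<in> carrier R" "f x = y"
  using assms bij that unfolding bij_betw_def by (metis imageE)

lemma diff_ring_source: "diff_ring R"
proof -
  note hom [simp] = one zero mult add der closed
  have "abelian_group R"
  proof (rule abelian_groupI)
    fix x assume x: "x \<in> carrier R"
    obtain y where "y \<in> carrier R" "f y = \<ominus>\<^bsub>S\<^esub> f x"
      using surjE[OF S.a_inv_closed[OF closed[OF x]]] by metis
    with x show "\<exists>y\<in>carrier R. y \<oplus>\<^bsub>R\<^esub> x = \<zero>\<^bsub>R\<^esub>"
      by (intro bexI[of _ y] eqI) (simp_all add: S.l_neg)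
  qed (auto intro!: eqI simp: S.a_ac)
  moreover have "comm_monoid R"
    by (rule comm_monoidI) (auto intro!: eqI simp: S.m_ac)
  ultimately have "cring R"
    by (rule cringI) (auto intro!: eqI simp: S.l_distr)
  then show ?thesis
    by (rule diff_ring.intro, unfold_locales)
      (auto intro!: eqI simp: S.der_add S.der_mult)
qed

lemma hom: "f \<in> diff_ring_hom R S"
  by (auto simp: diff_ring_hom_def ring_hom_def one zero mult add der closed)

end

text \<open>The restriction maps of \<open>F\<close> correspond to those of \<open>G\<close>, so functoriality is inherited by
  injectivity of the bijections.\<close>
lemma presheaf_transport:
  fixes F :: "('p, 's) presheaf" and G :: "('p, 't) presheaf"
  assumes G: "diff_ring_presheaf X G"
    and tr: "\<And>U. openin X U \<Longrightarrow> diff_ring_transport (sections F U) (sections G U) (\<phi> U)"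
    and restr: "\<And>U V s. \<lbrakk>openin X U; openin X V; V \<subseteq> U; s \<in> carrier (sections F U)\<rbrakk> \<Longrightarrow>
      restr F U V s \<in> carrier (sections F V) \<and> \<phi> V (restr F U V s) = restr G U V (\<phi> U s)"
  shows "diff_ring_presheaf X F"
proof (rule diff_ring_presheaf.intro)
  fix U assume U: "openin X U"
  interpret U: diff_ring_transport "sections F U" "sections G U" "\<phi> U" by (rule tr) fact
  show "diff_ring (sections F U)"
    by (rule U.diff_ring_source)
  show "restr F U U s = s" if "s \<in> carrier (sections F U)" for s
    using that U restr[OF U U _ that] by (auto intro!: U.eqI simp: diff_ring_presheaf.restr_id[OF G] U.closed)
  fix V assume V: "openin X V" "V \<subseteq> U"
  interpret V: diff_ring_transport "sections F V" "sections G V" "\<phi> V" by (rule tr) fact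
  show "restr F U V \<in> diff_ring_hom (sections F U) (sections F V)"
  proof -
    have "restr G U V \<in> diff_ring_hom (sections G U) (sections G V)"
      by (rule diff_ring_presheaf.restr_hom[OF G U V])
    then have G_hom: "restr G U V \<one>\<^bsub>sections G U\<^esub> = \<one>\<^bsub>sections G V\<^esub>"
      "x \<in> carrier (sections G U) \<Longrightarrow> restr G U V (der (sections G U) x) = der (sections G V) (restr G U V x)"
      "\<lbrakk>x \<in> carrier (sections G U); y \<in> carrier (sections G U)\<rbrakk> \<Longrightarrow>
        restr G U V (x \<oplus>\<^bsub>sections G U\<^esub> y) = restr G U V x \<oplus>\<^bsub>sections G V\<^esub> restr G U V y"
      "\<lbrakk>x \<in> carrier (sections G U); y \<in> carrier (sections G U)\<rbrakk> \<Longrightarrow>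
        restr G U V (x \<otimes>\<^bsub>sections G U\<^esub> y) = restr G U V x \<otimes>\<^bsub>sections G V\<^esub> restr G U V y"
      for x y
      by (auto simp: diff_ring_hom_def ring_hom_def)
    note r = restr[OF U V]
    show ?thesis
      unfolding diff_ring_hom_def ring_hom_def
      by (auto simp: r V.one V.mult V.add V.der U.one U.mult U.add U.der G_hom U.closed
          intro!: V.eqI)
  qed
  fix W s assume W: "openin X W" "W \<subseteq> V" and s: "s \<in> carrier (sections F U)"
  interpret W: diff_ring_transport "sections F W" "sections G W" "\<phi> W" by (rule tr) fact
  have WU: "W \<subseteq> U" using W V by auto
  note rs = restr[OF U V s] restr[OF U W(1) WU s]
  show "restr F V W (restr F U V s) = restr F U W s"
    using rs restr[OF V(1) W] diff_ring_presheaf.restr_comp[OF G U V(1) W(1) W(2) V(2)] U.closed[OF s]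
    by (intro W.eqI) auto
qed

text \<open>In addition to \<open>presheaf_transport\<close>, sections of \<open>F\<close> are glued by glueing their images in \<open>G\<close>.
  Thus one sheaf of differential rings and compatible bijections give both the second sheaf and the
  isomorphism.\<close>
lemma sheaf_transport:
  fixes F :: "('p, 's) presheaf" and G :: "('p, 't) presheaf"
  assumes G: "diff_ring_sheaf X G"
    and tr: "\<And>U. openin X U \<Longrightarrow> diff_ring_transport (sections F U) (sections G U) (\<phi> U)"
    and restr: "\<And>U V s. \<lbrakk>openin X U; openin X V; V \<subseteq> U; s \<in> carrier (sections F U)\<rbrakk> \<Longrightarrow>
      restr F U V s \<in> carrier (sections F V) \<and> \<phi> V (restr F U V s) = restr G U V (\<phi> U s)"
  shows "isomorphic_diff_ring_sheaves X F G"
proof -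
  interpret G: diff_ring_sheaf X G by fact
  have F: "diff_ring_presheaf X F"
    by (rule presheaf_transport[OF G.diff_ring_presheaf_axioms tr restr])
  have "diff_ring_sheaf X F"
  proof (rule diff_ring_sheaf.intro[OF F], rule diff_ring_sheaf_axioms.intro)
    fix U C s t
    assume U: "openin X U" and C: "\<And>V. V \<in> C \<Longrightarrow> openin X V" "\<Union>C = U"
      and st: "s \<in> carrier (sections F U)" "t \<in> carrier (sections F U)"
      and eq: "\<And>V. V \<in> C \<Longrightarrow> restr F U V s = restr F U V t"
    interpret U: diff_ring_transport "sections F U" "sections G U" "\<phi> U" by (rule tr) fact
    have VU: "V \<subseteq> U" if "V \<in> C" for V using that C(2) by auto
    have restr_eq: "restr G U V (\<phi> U s) = restr G U V (\<phi> U t)" if "V \<in> C" for V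
      using restr[OF U C(1)[OF that] VU[OF that]] st eq[OF that] by metis
    have "\<phi> U s = \<phi> U t"
      by (rule G.locality[OF U C]) (simp_all add: st U.closed restr_eq)
    then show "s = t"
      using st by (rule U.eqI)
  next
    fix U C \<sigma>
    assume U: "openin X U" and C: "\<And>V. V \<in> C \<Longrightarrow> openin X V" "\<Union>C = U"
      and \<sigma>: "\<And>V. V \<in> C \<Longrightarrow> \<sigma> V \<in> carrier (sections F V)"
      and eq: "\<And>V W. \<lbrakk>V \<in> C; W \<in> C\<rbrakk> \<Longrightarrow> restr F V (V \<inter> W) (\<sigma> V) = restr F W (V \<inter> W) (\<sigma> W)"
    interpret U: diff_ring_transport "sections F U" "sections G U" "\<phi> U" by (rule tr) fact
    have VU: "V \<subseteq> U" if "V \<in> C" for V using that C(2) by auto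
    have "\<exists>g\<in>carrier (sections G U). \<forall>V\<in>C. restr G U V g = \<phi> V (\<sigma> V)"
    proof (rule G.glueing[OF U C])
      show "\<phi> V (\<sigma> V) \<in> carrier (sections G V)" if "V \<in> C" for V
        using diff_ring_transport.closed[OF tr[OF C(1)[OF that]]] \<sigma> that by blast
      fix V W assume VW: "V \<in> C" "W \<in> C"
      then have o: "openin X (V \<inter> W)" using C(1) by blast
      show "restr G V (V \<inter> W) (\<phi> V (\<sigma> V)) = restr G W (V \<inter> W) (\<phi> W (\<sigma> W))"
        using restr[OF C(1)[OF VW(1)] o _ \<sigma>[OF VW(1)]] restr[OF C(1)[OF VW(2)] o _ \<sigma>[OF VW(2)]] eq[OF VW]
        by simp
    qed
    then obtain g where g: "g \<in> carrier (sections G U)" "\<And>V. V \<in> C \<Longrightarrow> restr G U V g = \<phi> V (\<sigma> V)"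
      by blast
    obtain s where s: "s \<in> carrier (sections F U)" "\<phi> U s = g"
      using U.surjE g(1) by blast
    have "restr F U V s = \<sigma> V" if V: "V \<in> C" for V
    proof -
      have "restr F U V s \<in> carrier (sections F V) \<and> \<phi> V (restr F U V s) = \<phi> V (\<sigma> V)"
        using restr[OF U C(1)[OF V] VU[OF V] s(1)] g(2)[OF V] s(2) by simp
      then show ?thesis
        using diff_ring_transport.eqI[OF tr[OF C(1)[OF V]]] \<sigma>[OF V] by blast
    qed
    with s(1) show "\<exists>s\<in>carrier (sections F U). \<forall>V\<in>C. restr F U V s = \<sigma> V"
      by blast
  qed
  moreover have "\<phi> U \<in> diff_ring_hom (sections F U) (sections G U)"
    "bij_betw (\<phi> U) (carrier (sections F U)) (carrier (sections G U))" if "openin X U" for U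
    using diff_ring_transport.hom[OF tr[OF that]] diff_ring_transport.bij[OF tr[OF that]] .
  ultimately show ?thesis
    unfolding isomorphic_diff_ring_sheaves_def using G restr by blast
qed

section \<open>Differential rings of functions\<close>

lemma pointwise_diff_ring_simps [simp]:
  "carrier (pointwise_diff_ring U K S) = S"
  "s \<otimes>\<^bsub>pointwise_diff_ring U K S\<^esub> t = (\<lambda>p\<in>U. s p \<otimes>\<^bsub>K p\<^esub> t p)"
  "s \<oplus>\<^bsub>pointwise_diff_ring U K S\<^esub> t = (\<lambda>p\<in>U. s p \<oplus>\<^bsub>K p\<^esub> t p)"
  "\<one>\<^bsub>pointwise_diff_ring U K S\<^esub> = (\<lambda>p\<in>U. \<one>\<^bsub>K p\<^esub>)"
  "\<zero>\<^bsub>pointwise_diff_ring U K S\<^esub> = (\<lambda>p\<in>U. \<zero>\<^bsub>K p\<^esub>)"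
  "der (pointwise_diff_ring U K S) s = (\<lambda>p\<in>U. der (K p) (s p))"
  by (simp_all add: pointwise_diff_ring_def)

lemma diff_ring_pointwise:
  assumes K: "\<And>p. p \<in> U \<Longrightarrow> diff_ring (K p)"
    and S: "S \<subseteq> (\<Pi>\<^sub>E p\<in>U. carrier (K p))"
    and closed: "(\<lambda>p\<in>U. \<one>\<^bsub>K p\<^esub>) \<in> S" "(\<lambda>p\<in>U. \<zero>\<^bsub>K p\<^esub>) \<in> S"
      "\<And>s t. \<lbrakk>s \<in> S; t \<in> S\<rbrakk> \<Longrightarrow> (\<lambda>p\<in>U. s p \<otimes>\<^bsub>K p\<^esub> t p) \<in> S"
      "\<And>s t. \<lbrakk>s \<in> S; t \<in> S\<rbrakk> \<Longrightarrow> (\<lambda>p\<in>U. s p \<oplus>\<^bsub>K p\<^esub> t p) \<in> S"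
      "\<And>s. s \<in> S \<Longrightarrow> (\<lambda>p\<in>U. \<ominus>\<^bsub>K p\<^esub> s p) \<in> S"
      "\<And>s. s \<in> S \<Longrightarrow> (\<lambda>p\<in>U. der (K p) (s p)) \<in> S"
  shows "diff_ring (pointwise_diff_ring U K S)"
proof -
  have cring: "cring (K p)" if "p \<in> U" for p
    using K[OF that] by (simp add: diff_ring_def)
  have val [simp]: "s p \<in> carrier (K p)" if "s \<in> S" "p \<in> U" for s p
    using S that by (auto simp: PiE_iff)
  have eqI: "s = t" if "s \<in> S" "t \<in> S" "\<And>p. p \<in> U \<Longrightarrow> s p = t p" for s t
    using that S by (intro PiE_ext[of s U "\<lambda>p. carrier (K p)" t]) auto
  note ax = cring.cring_simprules[OF cring] monoid.r_one[OF ring.is_monoid[OF cring.axioms(1)[OF cring]]]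
  have "abelian_group (pointwise_diff_ring U K S)"
  proof (rule abelian_groupI)
    fix s assume "s \<in> carrier (pointwise_diff_ring U K S)"
    then show "\<exists>t\<in>carrier (pointwise_diff_ring U K S).
        t \<oplus>\<^bsub>pointwise_diff_ring U K S\<^esub> s = \<zero>\<^bsub>pointwise_diff_ring U K S\<^esub>"
      using closed(4)[OF closed(5), of s s]
      by (intro bexI[of _ "\<lambda>p\<in>U. \<ominus>\<^bsub>K p\<^esub> s p"] eqI) (simp_all add: closed ax restrict_apply' del: restrict_apply)
  qed (auto intro!: eqI simp: closed ax restrict_apply' simp del: restrict_apply)
  moreover have "comm_monoid (pointwise_diff_ring U K S)"
    by (rule comm_monoidI) (auto intro!: eqI simp: closed ax restrict_apply' simp del: restrict_apply)
  ultimately have "cring (pointwise_diff_ring U K S)"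
    by (rule cringI) (auto intro!: eqI simp: closed ax restrict_apply' simp del: restrict_apply)
  then show ?thesis
    by (rule diff_ring.intro, unfold_locales)
      (auto intro!: eqI simp: closed restrict_apply' diff_ring.der_add[OF K] diff_ring.der_mult[OF K] simp del: restrict_apply)
qed

text \<open>Isomorphisms between the fibres induce an isomorphism between rings of functions, provided
  that the set \<open>S\<close> of functions on one side is the preimage of the set \<open>T\<close> on the other. Closure of \<open>S\<close>
  under the operations then follows from that of \<open>T\<close>.\<close>
lemma pointwise_transport:
  assumes tr: "\<And>p. p \<in> U \<Longrightarrow> diff_ring_transport (R p) (K p) (f p)"
    and T: "T \<subseteq> (\<Pi>\<^sub>E p\<in>U. carrier (K p))" "diff_ring (pointwise_diff_ring U K T)"
    and S: "\<And>s. s \<in> S \<longleftrightarrow> s \<in> (\<Pi>\<^sub>E p\<in>U. carrier (R p)) \<and> (\<lambda>p\<in>U. f p (s p)) \<in> T"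
  shows "diff_ring_transport (pointwise_diff_ring U R S) (pointwise_diff_ring U K T) (\<lambda>s. \<lambda>p\<in>U. f p (s p))"
    (is "diff_ring_transport ?R ?K ?f")
proof -
  interpret T: diff_ring ?K by (rule T(2))
  note loc = diff_ring_transport.one[OF tr] diff_ring_transport.zero[OF tr] diff_ring_transport.mult[OF tr]
    diff_ring_transport.add[OF tr] diff_ring_transport.der[OF tr]
  have val: "s p \<in> carrier (R p)" if "s \<in> S" "p \<in> U" for s p
    using that by (auto simp: S PiE_iff)
  have img: "?f s \<in> carrier ?K" if "s \<in> S" for s
    using that by (simp add: S)
  have memI: "s \<in> S" if "s \<in> (\<Pi>\<^sub>E p\<in>U. carrier (R p))" "t \<in> T" "\<And>p. p \<in> U \<Longrightarrow> f p (s p) = t p" for s t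
  proof -
    have "?f s = t"
      using that T(1) by (intro extensionalityI[of _ U]) (auto simp: PiE_iff subset_iff)
    then show ?thesis
      using that by (simp add: S)
  qed
  show ?thesis
  \<comment> \<open>After bijectivity, each operation contributes two cases: closure and compatibility.\<close>
  proof (unfold_locales, goal_cases)
    case 1
    have "inj_on ?f S"
    proof (rule inj_onI)
      fix s t assume st: "s \<in> S" "t \<in> S" "?f s = ?f t"
      then have "f p (s p) = f p (t p)" if "p \<in> U" for p
        using that by (metis restrict_apply')
      then show "s = t"
        using st(1,2) diff_ring_transport.eqI[OF tr] val
        by (intro PiE_ext[of s U "\<lambda>p. carrier (R p)" t]) (auto simp: S)
    qed
    moreover have "t \<in> ?f ` S" if t: "t \<in> T" for t
    proof -
      define s where "s = (\<lambda>p\<in>U. inv_into (carrier (R p)) (f p) (t p))"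
      have s: "s p \<in> carrier (R p) \<and> f p (s p) = t p" if "p \<in> U" for p
      proof -
        have "t p \<in> f p ` carrier (R p)"
          using diff_ring_transport.bij[OF tr[OF that]] t T(1) that by (auto simp: bij_betw_def PiE_iff subset_iff)
        then show ?thesis
          using that by (simp add: s_def inv_into_into f_inv_into_f)
      qed
      have "s \<in> S"
        by (rule memI[OF _ t]) (use s in \<open>auto simp: s_def\<close>)
      moreover have "?f s = t"
        using s t T(1) by (intro extensionalityI[of _ U]) (auto simp: PiE_iff subset_iff)
      ultimately show ?thesis
        by blast
    qed
    ultimately show ?case
      using img by (auto simp: bij_betw_def)
  next
    case 2 show ?case
      using T.one_closed by (auto intro!: memI simp: loc)
  next
    case 3 show ?case by (auto simp: loc intro!: restrict_ext)
  next
    case 4 show ?case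
      using T.zero_closed by (auto intro!: memI simp: loc)
  next
    case 5 show ?case by (auto simp: loc intro!: restrict_ext)
  next
    case (6 s t) then show ?case
      using T.m_closed[OF img img, of s t] by (auto intro!: memI simp: loc val)
  next
    case (7 s t) then show ?case by (auto simp: loc val intro!: restrict_ext)
  next
    case (8 s t) then show ?case
      using T.a_closed[OF img img, of s t] by (auto intro!: memI simp: loc val)
  next
    case (9 s t) then show ?case by (auto simp: loc val intro!: restrict_ext)
  next
    case (10 s) then show ?case
      using T.der_closed[OF img, of s] by (auto intro!: memI simp: loc val)
  next
    case (11 s) then show ?case by (auto simp: loc val intro!: restrict_ext)
  qed
qed

lemma pointwise_presheaf:
  fixes F :: "('p, 'p \<Rightarrow> 'k) presheaf"
  assumes F: "\<And>U. openin X U \<Longrightarrow> sections F U = pointwise_diff_ring U K (S U)"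
      "\<And>U V s. restr F U V s = restrict s V"
    and ring: "\<And>U. openin X U \<Longrightarrow> diff_ring (pointwise_diff_ring U K (S U))"
    and ext: "\<And>U. openin X U \<Longrightarrow> S U \<subseteq> extensional U"
    and restrict: "\<And>U V s. \<lbrakk>openin X U; openin X V; V \<subseteq> U; s \<in> S U\<rbrakk> \<Longrightarrow> restrict s V \<in> S V"
  shows "diff_ring_presheaf X F"
proof (rule diff_ring_presheaf.intro)
  fix U assume U: "openin X U"
  show "diff_ring (sections F U)"
    by (simp add: F U ring)
  show "restr F U U s = s" if "s \<in> carrier (sections F U)" for s
    using that ext[OF U] by (auto simp: F U extensional_restrict subset_iff)
  fix V assume V: "openin X V" "V \<subseteq> U"
  then show "restr F U V \<in> diff_ring_hom (sections F U) (sections F V)"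
    using restrict[OF U] by (auto simp: F U diff_ring_hom_def ring_hom_def fun_eq_iff)
  show "restr F V W (restr F U V s) = restr F U W s"
    if "openin X W" "W \<subseteq> V" "s \<in> carrier (sections F U)" for W s
    using that by (auto simp: F fun_eq_iff)
qed

section \<open>Sheaves of fractions\<close>

definition fraction_on ::
    "('a, 'm) ring_scheme \<Rightarrow> 'a set set \<Rightarrow> ('a set \<Rightarrow> ('a \<times> 'a) set) \<Rightarrow> 'a \<Rightarrow> 'a \<Rightarrow> bool" where
  "fraction_on R V s a b \<longleftrightarrow>
     a \<in> carrier R \<and> b \<in> carrier R \<and> (\<forall>P\<in>V. b \<notin> P \<and> s P = local_frac R P a b)"

text \<open>The covering by triples \<open>(U\<^sub>i, a\<^sub>i, b\<^sub>i)\<close> in the definition of the sections is replaced by the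
  existence of a fraction near each point. That the values lie in the localizations is then
  automatic (\<open>fraction_sections_subset\<close>).\<close>
definition fraction_sections ::
    "('a, 'm) ring_scheme \<Rightarrow> 'a set topology \<Rightarrow> 'a set set \<Rightarrow> ('a set \<Rightarrow> ('a \<times> 'a) set) set" where
  "fraction_sections R X U = {s \<in> extensional U.
     \<forall>P\<in>U. \<exists>V a b. openin X V \<and> P \<in> V \<and> V \<subseteq> U \<and> fraction_on R V s a b}"

lemma fraction_sectionsE:
  assumes "s \<in> fraction_sections R X U" "P \<in> U"
  obtains V a b where "openin X V" "P \<in> V" "V \<subseteq> U" "fraction_on R V s a b"
  using assms by (auto simp: fraction_sections_def)

lemma fraction_sections_extensional: "fraction_sections R X U \<subseteq> extensional U"
  by (auto simp: fraction_sections_def)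

lemma fraction_on_mono: "\<lbrakk>fraction_on R V s a b; W \<subseteq> V\<rbrakk> \<Longrightarrow> fraction_on R W s a b"
  by (auto simp: fraction_on_def)

lemma fraction_on_cong:
  "(\<And>P. P \<in> V \<Longrightarrow> s P = t P) \<Longrightarrow> fraction_on R V s a b \<longleftrightarrow> fraction_on R V t a b"
  by (auto simp: fraction_on_def)

text \<open>Common ground of the spectrum and the differential spectrum: a set of primes whose topology
  contains the traces of the basic open sets.\<close>
locale space_of_primes = diff_ring R for R :: "('a, 'm) diff_ring_scheme" (structure) +
  fixes X :: "'a set topology"
  assumes prime: "\<lbrakk>openin X U; P \<in> U\<rbrakk> \<Longrightarrow> primeideal P R"
    and basic_open: "\<lbrakk>openin X U; b \<in> carrier R\<rbrakk> \<Longrightarrow> openin X {P \<in> U. b \<notin> P}"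
begin

abbreviation "at_prime \<equiv> localization_at R"

lemma diff_ring_at_prime: "\<lbrakk>openin X U; P \<in> U\<rbrakk> \<Longrightarrow> diff_ring (at_prime P)"
  unfolding localization_at_def
  by (rule localized_diff_ring.diff_ring_localization[OF localized_at_prime[OF prime]])

text \<open>The operations on fractions are given by the same formulas at all primes, so they act on
  numerators and denominators uniformly over an open set.\<close>
lemma fraction_on_ops:
  assumes V: "openin X V" and s: "fraction_on R V s a b" and t: "fraction_on R V t c d"
  shows "fraction_on R V (\<lambda>P. \<one>\<^bsub>at_prime P\<^esub>) \<one> \<one>"
    and "fraction_on R V (\<lambda>P. \<zero>\<^bsub>at_prime P\<^esub>) \<zero> \<one>"
    and "fraction_on R V (\<lambda>P. s P \<otimes>\<^bsub>at_prime P\<^esub> t P) (a \<otimes> c) (b \<otimes> d)"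
    and "fraction_on R V (\<lambda>P. s P \<oplus>\<^bsub>at_prime P\<^esub> t P) (a \<otimes> d \<oplus> c \<otimes> b) (b \<otimes> d)"
    and "fraction_on R V (\<lambda>P. \<ominus>\<^bsub>at_prime P\<^esub> s P) (\<ominus> a) b"
    and "fraction_on R V (\<lambda>P. der (at_prime P) (s P)) (der R a \<otimes> b \<ominus> a \<otimes> der R b) (b \<otimes> b)"
proof -
  have abcd [simp]: "a \<in> carrier R" "b \<in> carrier R" "c \<in> carrier R" "d \<in> carrier R"
    using s t by (auto simp: fraction_on_def)
  have loc: "localized_diff_ring R (carrier R - P)" if "P \<in> V" for P
    by (rule localized_at_prime[OF prime[OF V that]])
  have bd: "b \<in> carrier R - P" "d \<in> carrier R - P" if "P \<in> V" for P
    using s t that by (auto simp: fraction_on_def)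
  have mem: "\<one> \<notin> P" "b \<otimes> d \<notin> P" "b \<otimes> b \<notin> P" if "P \<in> V" for P
    using localized_diff_ring.one_mem[OF loc[OF that]] localized_diff_ring.mult_mem[OF loc[OF that]] bd[OF that]
    by blast+
  note ops = localized_diff_ring.mult_frac[OF loc] localized_diff_ring.add_frac[OF loc]
    localized_diff_ring.a_inv_frac[OF loc] localized_diff_ring.der_frac[OF loc]
    localized_diff_ring.one_localization[OF loc] localized_diff_ring.zero_localization[OF loc]
  have val: "s P = local_frac R P a b" "t P = local_frac R P c d" if "P \<in> V" for P
    using s t that by (auto simp: fraction_on_def)
  show "fraction_on R V (\<lambda>P. \<one>\<^bsub>at_prime P\<^esub>) \<one> \<one>"
    "fraction_on R V (\<lambda>P. \<zero>\<^bsub>at_prime P\<^esub>) \<zero> \<one>"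
    "fraction_on R V (\<lambda>P. s P \<otimes>\<^bsub>at_prime P\<^esub> t P) (a \<otimes> c) (b \<otimes> d)"
    "fraction_on R V (\<lambda>P. s P \<oplus>\<^bsub>at_prime P\<^esub> t P) (a \<otimes> d \<oplus> c \<otimes> b) (b \<otimes> d)"
    "fraction_on R V (\<lambda>P. \<ominus>\<^bsub>at_prime P\<^esub> s P) (\<ominus> a) b"
    "fraction_on R V (\<lambda>P. der (at_prime P) (s P)) (der R a \<otimes> b \<ominus> a \<otimes> der R b) (b \<otimes> b)"
    using bd mem by (simp_all add: fraction_on_def localization_at_def val ops der_closed)
qed

lemma fraction_sections_subset:
  assumes U: "openin X U"
  shows "fraction_sections R X U \<subseteq> (\<Pi>\<^sub>E P\<in>U. carrier (at_prime P))"
proof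
  fix s assume s: "s \<in> fraction_sections R X U"
  have "s P \<in> carrier (at_prime P)" if P: "P \<in> U" for P
  proof -
    from s P obtain V a b where "P \<in> V" "fraction_on R V s a b"
      by (rule fraction_sectionsE)
    then show ?thesis
      using localized_diff_ring.frac_closed[OF localized_at_prime[OF prime[OF U P]], of a b]
      by (auto simp: fraction_on_def localization_at_def)
  qed
  with s show "s \<in> (\<Pi>\<^sub>E P\<in>U. carrier (at_prime P))"
    by (auto simp: fraction_sections_def PiE_iff)
qed

text \<open>From a function that is locally a fraction one recovers a covering family: all triples
  that represent it on some open subset form one.\<close>
lemma sections_fraction_sheaf:
  assumes U: "openin X U"
  shows "sections (fraction_sheaf R X) U = pointwise_diff_ring U at_prime (fraction_sections R X U)"
proof -
  have "{s \<in> (\<Pi>\<^sub>E P\<in>U. carrier (at_prime P)).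
          \<exists>C \<subseteq> Collect (openin X) \<times> carrier R \<times> carrier R.
            (\<Union>(V, a, b)\<in>C. V) = U \<and>
            (\<forall>(V, a, b)\<in>C. \<forall>P\<in>V. b \<notin> P \<and> s P = local_frac R P a b)} = fraction_sections R X U"
    (is "?S = _")
  proof (intro equalityI subsetI)
    fix s assume "s \<in> ?S"
    then obtain C where s: "s \<in> extensional U"
      and C: "C \<subseteq> Collect (openin X) \<times> carrier R \<times> carrier R" "(\<Union>(V, a, b)\<in>C. V) = U"
        "\<And>V a b. (V, a, b) \<in> C \<Longrightarrow> \<forall>P\<in>V. b \<notin> P \<and> s P = local_frac R P a b"
      by (fastforce simp: PiE_iff)
    have "\<exists>V a b. openin X V \<and> P \<in> V \<and> V \<subseteq> U \<and> fraction_on R V s a b" if "P \<in> U" for P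
    proof -
      have "P \<in> (\<Union>(V, a, b)\<in>C. V)"
        using that C(2) by simp
      then obtain V a b where V: "(V, a, b) \<in> C" "P \<in> V"
        by blast
      have "V \<subseteq> (\<Union>(V, a, b)\<in>C. V)"
        using V(1) by blast
      then have "V \<subseteq> U"
        using C(2) by simp
      moreover have "openin X V" "fraction_on R V s a b"
        using C(1) C(3)[OF V(1)] V(1) by (auto simp: fraction_on_def)
      ultimately show ?thesis
        using V(2) by blast
    qed
    with s show "s \<in> fraction_sections R X U"
      by (simp add: fraction_sections_def)
  next
    fix s assume s: "s \<in> fraction_sections R X U"
    let ?C = "{(V, a, b). openin X V \<and> V \<subseteq> U \<and> fraction_on R V s a b}"
    have "?C \<subseteq> Collect (openin X) \<times> carrier R \<times> carrier R"
      and "\<forall>(V, a, b)\<in>?C. \<forall>P\<in>V. b \<notin> P \<and> s P = local_frac R P a b"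
      by (auto simp: fraction_on_def)
    moreover have "(\<Union>(V, a, b)\<in>?C. V) = U"
    proof (intro equalityI subsetI)
      fix P assume "P \<in> U"
      with s obtain V a b where "openin X V" "P \<in> V" "V \<subseteq> U" "fraction_on R V s a b"
        by (rule fraction_sectionsE)
      then show "P \<in> (\<Union>(V, a, b)\<in>?C. V)"
        by (intro UN_I[of "(V, a, b)"]) auto
    qed auto
    ultimately have "\<exists>C \<subseteq> Collect (openin X) \<times> carrier R \<times> carrier R.
        (\<Union>(V, a, b)\<in>C. V) = U \<and> (\<forall>(V, a, b)\<in>C. \<forall>P\<in>V. b \<notin> P \<and> s P = local_frac R P a b)"
      by (intro exI[of _ ?C] conjI)
    with s show "s \<in> ?S"
      using fraction_sections_subset[OF U] by blast
  qed
  then show ?thesis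
    by (simp add: fraction_sheaf_def)
qed

lemma restr_fraction_sheaf: "restr (fraction_sheaf R X) U V s = restrict s V"
  by (simp add: fraction_sheaf_def)

lemma restrict_fraction_mem:
  assumes "openin X U" "fraction_on R U s a b"
  shows "restrict s U \<in> fraction_sections R X U"
proof -
  have "fraction_on R U (restrict s U) a b"
    using assms(2) by (auto simp: fraction_on_def)
  with assms(1) show ?thesis
    by (auto simp: fraction_sections_def)
qed

text \<open>The function \<open>t\<close> allows for a section given by a formula without the default value that
  \<open>restrict\<close> imposes outside \<open>U\<close>.\<close>
lemma fraction_sectionsI:
  assumes "s \<in> extensional U"
    and "\<And>P. P \<in> U \<Longrightarrow> \<exists>V t. openin X V \<and> P \<in> V \<and> V \<subseteq> U \<and> (\<forall>Q\<in>V. s Q = t Q) \<and> (\<exists>a b. fraction_on R V t a b)"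
  shows "s \<in> fraction_sections R X U"
  using assms unfolding fraction_sections_def by (auto cong: fraction_on_cong) (metis fraction_on_cong)

lemma fraction_sections_closed:
  assumes U: "openin X U"
  shows "(\<lambda>P\<in>U. \<one>\<^bsub>at_prime P\<^esub>) \<in> fraction_sections R X U"
    and "(\<lambda>P\<in>U. \<zero>\<^bsub>at_prime P\<^esub>) \<in> fraction_sections R X U"
    and "\<lbrakk>s \<in> fraction_sections R X U; t \<in> fraction_sections R X U\<rbrakk> \<Longrightarrow>
      (\<lambda>P\<in>U. s P \<otimes>\<^bsub>at_prime P\<^esub> t P) \<in> fraction_sections R X U"
    and "\<lbrakk>s \<in> fraction_sections R X U; t \<in> fraction_sections R X U\<rbrakk> \<Longrightarrow>
      (\<lambda>P\<in>U. s P \<oplus>\<^bsub>at_prime P\<^esub> t P) \<in> fraction_sections R X U"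
    and "s \<in> fraction_sections R X U \<Longrightarrow> (\<lambda>P\<in>U. \<ominus>\<^bsub>at_prime P\<^esub> s P) \<in> fraction_sections R X U"
    and "s \<in> fraction_sections R X U \<Longrightarrow> (\<lambda>P\<in>U. der (at_prime P) (s P)) \<in> fraction_sections R X U"
proof -
  have const: "fraction_on R U (\<lambda>P. local_frac R P \<one> \<one>) \<one> \<one>"
    using localized_diff_ring.one_mem[OF localized_at_prime[OF prime[OF U]]] by (auto simp: fraction_on_def)
  show "(\<lambda>P\<in>U. \<one>\<^bsub>at_prime P\<^esub>) \<in> fraction_sections R X U"
    "(\<lambda>P\<in>U. \<zero>\<^bsub>at_prime P\<^esub>) \<in> fraction_sections R X U"
    by (rule restrict_fraction_mem[OF U], rule fraction_on_ops[OF U const const])+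
  have binary: "(\<lambda>P\<in>U. f P (s P) (t P)) \<in> fraction_sections R X U"
    if s: "s \<in> fraction_sections R X U" and t: "t \<in> fraction_sections R X U"
      and f: "\<And>V a b c d. \<lbrakk>openin X V; fraction_on R V s a b; fraction_on R V t c d\<rbrakk> \<Longrightarrow>
        \<exists>a b. fraction_on R V (\<lambda>P. f P (s P) (t P)) a b" for f s t
  proof (rule fraction_sectionsI)
    fix P assume P: "P \<in> U"
    from s P obtain V a b where V: "openin X V" "P \<in> V" "V \<subseteq> U" "fraction_on R V s a b"
      by (rule fraction_sectionsE)
    from t P obtain W c d where W: "openin X W" "P \<in> W" "W \<subseteq> U" "fraction_on R W t c d"
      by (rule fraction_sectionsE)
    have VW: "openin X (V \<inter> W)"
      using V W by blast
    then have "\<exists>a b. fraction_on R (V \<inter> W) (\<lambda>P. f P (s P) (t P)) a b"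
      by (rule f[OF _ fraction_on_mono[OF V(4)] fraction_on_mono[OF W(4)]]) auto
    with VW show "\<exists>V t'. openin X V \<and> P \<in> V \<and> V \<subseteq> U \<and>
        (\<forall>Q\<in>V. (\<lambda>P\<in>U. f P (s P) (t P)) Q = t' Q) \<and> (\<exists>a b. fraction_on R V t' a b)"
      using V W by (intro exI[of _ "V \<inter> W"] exI[of _ "\<lambda>P. f P (s P) (t P)"]) auto
  qed simp
  have unary: "(\<lambda>P\<in>U. f P (s P)) \<in> fraction_sections R X U"
    if "s \<in> fraction_sections R X U"
      and "\<And>V a b. \<lbrakk>openin X V; fraction_on R V s a b\<rbrakk> \<Longrightarrow> \<exists>a b. fraction_on R V (\<lambda>P. f P (s P)) a b" for f s
    using binary[of s s "\<lambda>P x y. f P x"] that by blast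
  {
    assume st: "s \<in> fraction_sections R X U" "t \<in> fraction_sections R X U"
    show "(\<lambda>P\<in>U. s P \<otimes>\<^bsub>at_prime P\<^esub> t P) \<in> fraction_sections R X U"
      by (rule binary[OF st], intro exI, rule fraction_on_ops(3))
    show "(\<lambda>P\<in>U. s P \<oplus>\<^bsub>at_prime P\<^esub> t P) \<in> fraction_sections R X U"
      by (rule binary[OF st], intro exI, rule fraction_on_ops(4))
  }
  assume s: "s \<in> fraction_sections R X U"
  show "(\<lambda>P\<in>U. \<ominus>\<^bsub>at_prime P\<^esub> s P) \<in> fraction_sections R X U"
    by (rule unary[OF s], intro exI, rule fraction_on_ops(5))
  show "(\<lambda>P\<in>U. der (at_prime P) (s P)) \<in> fraction_sections R X U"
    by (rule unary[OF s], intro exI, rule fraction_on_ops(6))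
qed

lemma diff_ring_fraction_sections:
  assumes U: "openin X U"
  shows "diff_ring (pointwise_diff_ring U at_prime (fraction_sections R X U))"
  by (rule diff_ring_pointwise)
    (simp_all add: diff_ring_at_prime[OF U] fraction_sections_subset[OF U] fraction_sections_closed[OF U])

lemma restrict_fraction_sections:
  assumes "openin X V" "V \<subseteq> U" "s \<in> fraction_sections R X U"
  shows "restrict s V \<in> fraction_sections R X V"
proof (rule fraction_sectionsI)
  fix P assume P: "P \<in> V"
  with assms obtain W a b where W: "openin X W" "P \<in> W" "fraction_on R W s a b"
    by (meson fraction_sectionsE subsetD)
  then show "\<exists>W t. openin X W \<and> P \<in> W \<and> W \<subseteq> V \<and> (\<forall>Q\<in>W. restrict s V Q = t Q) \<and> (\<exists>a b. fraction_on R W t a b)"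
    using assms P by (intro exI[of _ "W \<inter> V"] exI[of _ s]) (auto intro: fraction_on_mono)
qed simp

text \<open>Being locally a fraction is a local condition on functions, so sections are glued as functions:
  the value at \<open>P\<close> is read off from any member of the covering that contains \<open>P\<close>.\<close>
lemma diff_ring_sheaf_fraction_sheaf: "diff_ring_sheaf X (fraction_sheaf R X)"
proof (rule diff_ring_sheaf.intro)
  let ?F = "fraction_sheaf R X"
  note F = sections_fraction_sheaf restr_fraction_sheaf
  show "diff_ring_presheaf X ?F"
    by (rule pointwise_presheaf[OF F])
      (simp_all add: diff_ring_fraction_sections restrict_fraction_sections fraction_sections_extensional)
  show "diff_ring_sheaf_axioms X ?F"
  proof
    fix U C s t
    assume U: "openin X U" and C: "\<And>V. V \<in> C \<Longrightarrow> openin X V" "\<Union>C = U"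
      and st: "s \<in> carrier (sections ?F U)" "t \<in> carrier (sections ?F U)"
      and eq: "\<And>V. V \<in> C \<Longrightarrow> restr ?F U V s = restr ?F U V t"
    show "s = t"
    proof (rule extensionalityI[of _ U])
      fix P assume "P \<in> U"
      then obtain V where "V \<in> C" "P \<in> V" using C(2) by blast
      with eq[of V] show "s P = t P"
        by (metis restr_fraction_sheaf restrict_apply')
    qed (use st in \<open>auto simp: F U fraction_sections_def\<close>)
  next
    fix U C \<sigma>
    assume U: "openin X U" and C: "\<And>V. V \<in> C \<Longrightarrow> openin X V" "\<Union>C = U"
      and \<sigma>: "\<And>V. V \<in> C \<Longrightarrow> \<sigma> V \<in> carrier (sections ?F V)"
      and eq: "\<And>V W. \<lbrakk>V \<in> C; W \<in> C\<rbrakk> \<Longrightarrow> restr ?F V (V \<inter> W) (\<sigma> V) = restr ?F W (V \<inter> W) (\<sigma> W)"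
    define s where "s = (\<lambda>P\<in>U. \<sigma> (SOME V. V \<in> C \<and> P \<in> V) P)"
    have s: "s P = \<sigma> V P" if "V \<in> C" "P \<in> V" for V P
    proof -
      define W where "W = (SOME W. W \<in> C \<and> P \<in> W)"
      have W: "W \<in> C" "P \<in> W"
        using someI[of "\<lambda>W. W \<in> C \<and> P \<in> W" V] that by (auto simp: W_def)
      have "\<sigma> V P = \<sigma> W P"
        using fun_cong[OF eq[OF that(1) W(1)], of P] that W by (simp add: F)
      moreover have "P \<in> U" using that C(2) by blast
      ultimately show ?thesis
        by (simp add: s_def W_def)
    qed
    have \<sigma>': "\<sigma> V \<in> fraction_sections R X V" if "V \<in> C" for V
      using \<sigma>[OF that] C(1)[OF that] by (simp add: F)
    have "s \<in> fraction_sections R X U"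
    proof (rule fraction_sectionsI)
      fix P assume "P \<in> U"
      then obtain V where V: "V \<in> C" "P \<in> V" using C(2) by blast
      obtain W a b where W: "openin X W" "P \<in> W" "W \<subseteq> V" "fraction_on R W (\<sigma> V) a b"
        using fraction_sectionsE[OF \<sigma>'[OF V(1)] V(2)] by blast
      then show "\<exists>V t. openin X V \<and> P \<in> V \<and> V \<subseteq> U \<and> (\<forall>Q\<in>V. s Q = t Q) \<and> (\<exists>a b. fraction_on R V t a b)"
        using V C(2) s by (intro exI[of _ W] exI[of _ "\<sigma> V"]) blast
    qed (simp add: s_def)
    moreover have "restr ?F U V s = \<sigma> V" if "V \<in> C" for V
      using that s \<sigma>'[OF that] by (intro extensionalityI[of _ V]) (auto simp: F fraction_sections_def)
    ultimately show "\<exists>s\<in>carrier (sections ?F U). \<forall>V\<in>C. restr ?F U V s = \<sigma> V"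
      using U by (auto simp: F)
  qed
qed

lemma constant_fraction_mem:
  assumes "openin X U" "a \<in> carrier R" "b \<in> carrier R" "\<And>P. P \<in> U \<Longrightarrow> b \<notin> P"
  shows "(\<lambda>P\<in>U. local_frac R P a b) \<in> fraction_sections R X U"
  using assms by (intro restrict_fraction_mem[of _ _ a b]) (auto simp: fraction_on_def)

text \<open>Equality of two sections at a point spreads to a neighbourhood, since the element outside \<open>P\<close>
  that witnesses the equality of the fractions at \<open>P\<close> lies outside all primes near \<open>P\<close>. This is
  what makes evaluation of germs injective.\<close>
lemma eq_near:
  assumes s: "s \<in> fraction_sections R X V" and t: "t \<in> fraction_sections R X V'"
    and P: "P \<in> V" "P \<in> V'" "s P = t P"
  shows "\<exists>W. openin X W \<and> P \<in> W \<and> W \<subseteq> V \<inter> V' \<and> (\<forall>Q\<in>W. s Q = t Q)"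
proof -
  from s P(1) obtain V1 a b where V1: "openin X V1" "P \<in> V1" "V1 \<subseteq> V" "fraction_on R V1 s a b"
    by (rule fraction_sectionsE)
  from t P(2) obtain V2 c d where V2: "openin X V2" "P \<in> V2" "V2 \<subseteq> V'" "fraction_on R V2 t c d"
    by (rule fraction_sectionsE)
  have abcd: "a \<in> carrier R" "c \<in> carrier R" "b \<in> carrier R - Q" "d \<in> carrier R - Q" if "Q \<in> V1 \<inter> V2" for Q
    using V1(4) V2(4) that by (auto simp: fraction_on_def)
  have loc: "localized_diff_ring R (carrier R - Q)" if "Q \<in> V1 \<inter> V2" for Q
    using localized_at_prime prime V1(1) that by blast
  have PV: "P \<in> V1 \<inter> V2"
    using V1 V2 by blast
  have "local_frac R P a b = local_frac R P c d"
    using P(3) V1(2,4) V2(2,4) by (auto simp: fraction_on_def)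
  then obtain u where u: "u \<in> carrier R - P" "u \<otimes> (a \<otimes> d) = u \<otimes> (c \<otimes> b)"
    using localized_diff_ring.frac_eq_iff[OF loc abcd, OF PV PV PV PV PV] by blast
  let ?W = "{Q \<in> V1 \<inter> V2. u \<notin> Q}"
  have "s Q = t Q" if Q: "Q \<in> ?W" for Q
  proof -
    have Q': "Q \<in> V1 \<inter> V2" using Q by blast
    have "local_frac R Q a b = local_frac R Q c d"
      using localized_diff_ring.frac_cong[OF loc abcd, OF Q' Q' Q' Q' Q' _ u(2)] Q u(1) by blast
    then show ?thesis
      using Q' V1(4) V2(4) by (auto simp: fraction_on_def)
  qed
  moreover have "openin X ?W"
    using V1(1) V2(1) u(1) by (intro basic_open) auto
  ultimately show ?thesis
    using V1 V2 u(1) by (intro exI[of _ ?W]) auto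
qed

end

section \<open>Direct limits\<close>

text \<open>On an element of a direct limit, a compatible family of maps has the same value at all
  representatives. On other sets \<open>limit_value h\<close> is arbitrary.\<close>
definition limit_value :: "('p set \<Rightarrow> 's \<Rightarrow> 'k) \<Rightarrow> ('p set \<times> 's) set \<Rightarrow> 'k" where
  "limit_value h \<xi> = (THE k. \<forall>(V, s)\<in>\<xi>. h V s = k)"

text \<open>A compatible family \<open>h\<close> of homomorphisms from the rings of sections to \<open>K\<close> that exhibits \<open>K\<close> as
  their direct limit: every element is attained, and sections with equal images already agree on a
  smaller member of \<open>N\<close>.\<close>
locale direct_limit_cocone =
  F: diff_ring_presheaf X F + K: diff_ring K
  for X :: "'p topology" and F :: "('p, 's) presheaf" and K :: "('k, 'm) diff_ring_scheme" +
  fixes N :: "'p set set" and h :: "'p set \<Rightarrow> 's \<Rightarrow> 'k"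
  assumes N_open: "V \<in> N \<Longrightarrow> openin X V"
    and N_nonempty: "N \<noteq> {}"
    and N_inter: "\<lbrakk>V \<in> N; W \<in> N\<rbrakk> \<Longrightarrow> V \<inter> W \<in> N"
    and h_hom: "V \<in> N \<Longrightarrow> h V \<in> diff_ring_hom (sections F V) K"
    and h_restr: "\<lbrakk>V \<in> N; W \<in> N; W \<subseteq> V; s \<in> carrier (sections F V)\<rbrakk> \<Longrightarrow> h W (restr F V W s) = h V s"
    and h_surj: "k \<in> carrier K \<Longrightarrow> \<exists>V\<in>N. \<exists>s\<in>carrier (sections F V). h V s = k"
    and h_inj: "\<lbrakk>V \<in> N; V' \<in> N; s \<in> carrier (sections F V); s' \<in> carrier (sections F V'); h V s = h V' s'\<rbrakk>
      \<Longrightarrow> \<exists>W\<in>N. W \<subseteq> V \<inter> V' \<and> restr F V W s = restr F V' W s'"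
begin

text \<open>The fibre of the family \<open>h\<close> over \<open>k\<close>. Fibres are exactly the elements of the direct limit, which
  reduces every computation with classes to one in \<open>K\<close>.\<close>
definition representatives :: "'k \<Rightarrow> ('p set \<times> 's) set" where
  "representatives k = {(V, s). V \<in> N \<and> s \<in> carrier (sections F V) \<and> h V s = k}"

lemma germ_eq_representatives:
  assumes "V \<in> N" "s \<in> carrier (sections F V)"
  shows "germ F N V s = representatives (h V s)"
proof -
  have "(\<exists>W\<in>N. W \<subseteq> V \<inter> V' \<and> restr F V W s = restr F V' W s') \<longleftrightarrow> h V' s' = h V s"
    if "V' \<in> N" "s' \<in> carrier (sections F V')" for V' s'
  proof
    assume "\<exists>W\<in>N. W \<subseteq> V \<inter> V' \<and> restr F V W s = restr F V' W s'"
    then obtain W where "W \<in> N" "W \<subseteq> V \<inter> V'" "restr F V W s = restr F V' W s'"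
      by blast
    then show "h V' s' = h V s"
      using h_restr[of V W s] h_restr[of V' W s'] assms that by auto
  next
    assume "h V' s' = h V s"
    then show "\<exists>W\<in>N. W \<subseteq> V \<inter> V' \<and> restr F V W s = restr F V' W s'"
      using h_inj assms that by metis
  qed
  then show ?thesis
    unfolding germ_def representatives_def by auto
qed

lemma limit_value_representatives:
  assumes "k \<in> carrier K"
  shows "limit_value h (representatives k) = k"
proof -
  obtain V s where "(V, s) \<in> representatives k"
    using h_surj[OF assms] by (auto simp: representatives_def)
  then show ?thesis
    unfolding limit_value_def by (intro the_equality) (auto simp: representatives_def)
qed

lemma h_closed: "\<lbrakk>V \<in> N; s \<in> carrier (sections F V)\<rbrakk> \<Longrightarrow> h V s \<in> carrier K"
  by (rule diff_ring_hom_closed[OF h_hom])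

lemma limit_value_germ:
  "\<lbrakk>V \<in> N; s \<in> carrier (sections F V)\<rbrakk> \<Longrightarrow> limit_value h (germ F N V s) = h V s"
  by (simp add: germ_eq_representatives limit_value_representatives h_closed)

lemma germ_closed:
  "\<lbrakk>V \<in> N; s \<in> carrier (sections F V)\<rbrakk> \<Longrightarrow> germ F N V s \<in> carrier (direct_limit F N)"
  by (auto simp: direct_limit_def)

lemma sections_closed:
  assumes "V \<in> N"
  shows "\<one>\<^bsub>sections F V\<^esub> \<in> carrier (sections F V)" "\<zero>\<^bsub>sections F V\<^esub> \<in> carrier (sections F V)"
    "\<lbrakk>s \<in> carrier (sections F V); t \<in> carrier (sections F V)\<rbrakk> \<Longrightarrow> s \<otimes>\<^bsub>sections F V\<^esub> t \<in> carrier (sections F V)"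
    "\<lbrakk>s \<in> carrier (sections F V); t \<in> carrier (sections F V)\<rbrakk> \<Longrightarrow> s \<oplus>\<^bsub>sections F V\<^esub> t \<in> carrier (sections F V)"
    "s \<in> carrier (sections F V) \<Longrightarrow> der (sections F V) s \<in> carrier (sections F V)"
proof -
  interpret V: diff_ring "sections F V"
    using F.sections_diff_ring N_open assms by blast
  show "\<one>\<^bsub>sections F V\<^esub> \<in> carrier (sections F V)" "\<zero>\<^bsub>sections F V\<^esub> \<in> carrier (sections F V)"
    "\<lbrakk>s \<in> carrier (sections F V); t \<in> carrier (sections F V)\<rbrakk> \<Longrightarrow> s \<otimes>\<^bsub>sections F V\<^esub> t \<in> carrier (sections F V)"
    "\<lbrakk>s \<in> carrier (sections F V); t \<in> carrier (sections F V)\<rbrakk> \<Longrightarrow> s \<oplus>\<^bsub>sections F V\<^esub> t \<in> carrier (sections F V)"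
    "s \<in> carrier (sections F V) \<Longrightarrow> der (sections F V) s \<in> carrier (sections F V)"
    by (simp_all add: V.der_closed)
qed

lemma h_ops:
  assumes "V \<in> N"
  shows "h V \<one>\<^bsub>sections F V\<^esub> = \<one>\<^bsub>K\<^esub>" "h V \<zero>\<^bsub>sections F V\<^esub> = \<zero>\<^bsub>K\<^esub>"
    "\<lbrakk>s \<in> carrier (sections F V); t \<in> carrier (sections F V)\<rbrakk> \<Longrightarrow> h V (s \<otimes>\<^bsub>sections F V\<^esub> t) = h V s \<otimes>\<^bsub>K\<^esub> h V t"
    "\<lbrakk>s \<in> carrier (sections F V); t \<in> carrier (sections F V)\<rbrakk> \<Longrightarrow> h V (s \<oplus>\<^bsub>sections F V\<^esub> t) = h V s \<oplus>\<^bsub>K\<^esub> h V t"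
    "s \<in> carrier (sections F V) \<Longrightarrow> h V (der (sections F V) s) = der K (h V s)"
proof -
  interpret V: diff_ring "sections F V"
    using F.sections_diff_ring N_open assms by blast
  have hom: "h V \<in> ring_hom (sections F V) K"
    using h_hom[OF assms] by (simp add: diff_ring_hom_def)
  show "h V \<zero>\<^bsub>sections F V\<^esub> = \<zero>\<^bsub>K\<^esub>"
    by (rule ring_hom_zero[OF hom V.ring_axioms K.ring_axioms])
  show "h V \<one>\<^bsub>sections F V\<^esub> = \<one>\<^bsub>K\<^esub>"
    "\<lbrakk>s \<in> carrier (sections F V); t \<in> carrier (sections F V)\<rbrakk> \<Longrightarrow> h V (s \<otimes>\<^bsub>sections F V\<^esub> t) = h V s \<otimes>\<^bsub>K\<^esub> h V t"
    "\<lbrakk>s \<in> carrier (sections F V); t \<in> carrier (sections F V)\<rbrakk> \<Longrightarrow> h V (s \<oplus>\<^bsub>sections F V\<^esub> t) = h V s \<oplus>\<^bsub>K\<^esub> h V t"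
    "s \<in> carrier (sections F V) \<Longrightarrow> h V (der (sections F V) s) = der K (h V s)"
    using h_hom[OF assms] by (auto simp: diff_ring_hom_def ring_hom_def)
qed

lemma restr_closed:
  assumes "V \<in> N" "W \<in> N" "W \<subseteq> V" "s \<in> carrier (sections F V)"
  shows "restr F V W s \<in> carrier (sections F W)"
  using diff_ring_hom_closed[OF F.restr_hom[OF N_open[OF assms(1)] N_open[OF assms(2)] assms(3)] assms(4)] .

lemma germ_binary:
  assumes "(V, s) \<in> representatives k" "(W, t) \<in> representatives l"
  shows "germ F N (V \<inter> W) (restr F V (V \<inter> W) s \<otimes>\<^bsub>sections F (V \<inter> W)\<^esub> restr F W (V \<inter> W) t)
      = representatives (k \<otimes>\<^bsub>K\<^esub> l)"
    and "germ F N (V \<inter> W) (restr F V (V \<inter> W) s \<oplus>\<^bsub>sections F (V \<inter> W)\<^esub> restr F W (V \<inter> W) t)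
      = representatives (k \<oplus>\<^bsub>K\<^esub> l)"
  using assms N_inter[of V W] restr_closed[of V "V \<inter> W" s] restr_closed[of W "V \<inter> W" t]
  by (simp_all add: representatives_def germ_eq_representatives[unfolded representatives_def]
      sections_closed h_ops h_restr)

lemma representatives_ops:
  assumes k: "k \<in> carrier K"
  shows "l \<in> carrier K \<Longrightarrow> representatives k \<otimes>\<^bsub>direct_limit F N\<^esub> representatives l = representatives (k \<otimes>\<^bsub>K\<^esub> l)"
    and "l \<in> carrier K \<Longrightarrow> representatives k \<oplus>\<^bsub>direct_limit F N\<^esub> representatives l = representatives (k \<oplus>\<^bsub>K\<^esub> l)"
    and "der (direct_limit F N) (representatives k) = representatives (der K k)"
proof -
  obtain V s where Vs: "(V, s) \<in> representatives k"
    using h_surj[OF k] by (auto simp: representatives_def)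
  have "germ F N W (der (sections F W) t) = representatives (der K k)" if "(W, t) \<in> representatives k" for W t
    using that by (simp add: representatives_def germ_eq_representatives[unfolded representatives_def]
        sections_closed h_ops)
  then show "der (direct_limit F N) (representatives k) = representatives (der K k)"
    unfolding direct_limit_def diff_ring.simps by (rule UN_pair_eq[OF Vs])
  assume "l \<in> carrier K"
  then obtain W t where Wt: "(W, t) \<in> representatives l"
    using h_surj by (fastforce simp: representatives_def)
  show "representatives k \<otimes>\<^bsub>direct_limit F N\<^esub> representatives l = representatives (k \<otimes>\<^bsub>K\<^esub> l)"
    unfolding direct_limit_def monoid.simps
    by (rule UN_pair_eq[OF Vs], rule UN_pair_eq[OF Wt]) (rule germ_binary)
  show "representatives k \<oplus>\<^bsub>direct_limit F N\<^esub> representatives l = representatives (k \<oplus>\<^bsub>K\<^esub> l)"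
    unfolding direct_limit_def ring.simps
    by (rule UN_pair_eq[OF Vs], rule UN_pair_eq[OF Wt]) (rule germ_binary)
qed

lemma representatives_consts:
  "\<one>\<^bsub>direct_limit F N\<^esub> = representatives \<one>\<^bsub>K\<^esub>"
  "\<zero>\<^bsub>direct_limit F N\<^esub> = representatives \<zero>\<^bsub>K\<^esub>"
  using N_nonempty by (auto simp: direct_limit_def germ_eq_representatives sections_closed h_ops)

lemma carrier_direct_limit: "carrier (direct_limit F N) = representatives ` carrier K"
proof -
  have "representatives k \<in> carrier (direct_limit F N)" if k: "k \<in> carrier K" for k
  proof -
    obtain V s where "V \<in> N" "s \<in> carrier (sections F V)" "h V s = k"
      using h_surj[OF k] by blast
    then show ?thesis
      using germ_closed germ_eq_representatives by metis
  qed
  then show ?thesis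
    by (auto simp: direct_limit_def germ_eq_representatives h_closed)
qed

text \<open>The universal property in the form needed here: the direct limit inherits its differential ring
  structure from \<open>K\<close>, with evaluation as the isomorphism and \<open>representatives\<close> as its inverse.\<close>
lemma direct_limit_transport: "diff_ring_transport (direct_limit F N) K (limit_value h)"
proof (unfold_locales, goal_cases)
  case 1 show ?case
    by (intro bij_betw_byWitness[where f' = representatives])
      (auto simp: carrier_direct_limit limit_value_representatives)
qed (auto simp: carrier_direct_limit limit_value_representatives representatives_ops representatives_consts
    K.der_closed)

end

section \<open>Fractions near a set of primes\<close>

text \<open>Functions on \<open>U\<close> that extend to a section of the structure sheaf over an open neighbourhood of \<open>U\<close>
  in the full spectrum.\<close>
definition neighbourhood_sections ::
    "('a, 'm) diff_ring_scheme \<Rightarrow> 'a set set \<Rightarrow> ('a set \<Rightarrow> ('a \<times> 'a) set) set" where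
  "neighbourhood_sections R U =
    {restrict s U | V s. openin (zariski R) V \<and> U \<subseteq> V \<and> s \<in> fraction_sections R (zariski R) V}"

lemma neighbourhood_sectionsI:
  "\<lbrakk>openin (zariski R) V; U \<subseteq> V; s \<in> fraction_sections R (zariski R) V\<rbrakk> \<Longrightarrow>
    restrict s U \<in> neighbourhood_sections R U"
  by (auto simp: neighbourhood_sections_def)

lemma neighbourhood_sectionsE:
  assumes "t \<in> neighbourhood_sections R U"
  obtains V s where "openin (zariski R) V" "U \<subseteq> V" "s \<in> fraction_sections R (zariski R) V" "t = restrict s U"
  using assms by (auto simp: neighbourhood_sections_def)

abbreviation neighbourhood_ring ::
    "('a, 'm) diff_ring_scheme \<Rightarrow> 'a set set \<Rightarrow> ('a set \<Rightarrow> ('a \<times> 'a) set) diff_ring" where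
  "neighbourhood_ring R U \<equiv> pointwise_diff_ring U (localization_at R) (neighbourhood_sections R U)"

abbreviation neighbourhoods :: "('a, 'm) diff_ring_scheme \<Rightarrow> 'a set set \<Rightarrow> 'a set set set" where
  "neighbourhoods R U \<equiv> {V. openin (zariski R) V \<and> U \<subseteq> V}"

abbreviation trace_presheaf ::
    "('a, 'm) diff_ring_scheme \<Rightarrow> ('a set, ('a set set \<times> ('a set \<Rightarrow> ('a \<times> 'a) set)) set) presheaf" where
  "trace_presheaf R \<equiv> presheaf_inverse_image (zariski R) (structure_sheaf R)"

text \<open>The function on \<open>U\<close> that an element of the direct limit over the neighbourhoods of \<open>U\<close> determines.\<close>
definition germ_values ::
    "'p set \<Rightarrow> ('p set \<times> ('p \<Rightarrow> 'k)) set \<Rightarrow> 'p \<Rightarrow> 'k" where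
  "germ_values U = limit_value (\<lambda>V s. restrict s U)"

context diff_ring
begin

lemma space_of_primes_zariski: "space_of_primes R (zariski R)"
proof (rule space_of_primes.intro[OF diff_ring_axioms], rule space_of_primes_axioms.intro)
  fix U assume U: "openin (zariski R) U"
  then show "primeideal P R" if "P \<in> U" for P
    using that by (auto simp: openin_zariski primes_def)
  fix b assume "b \<in> carrier R"
  then have "openin (zariski R) {P \<in> primes R. \<not> {b} \<subseteq> P}"
    unfolding openin_zariski by blast
  with U have "openin (zariski R) (U \<inter> {P \<in> primes R. \<not> {b} \<subseteq> P})"
    by blast
  moreover have "U \<inter> {P \<in> primes R. \<not> {b} \<subseteq> P} = {P \<in> U. b \<notin> P}"
    using U by (auto simp: openin_zariski)
  ultimately show "openin (zariski R) {P \<in> U. b \<notin> P}"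
    by simp
qed

interpretation spec: space_of_primes R "zariski R"
  by (rule space_of_primes_zariski)

lemma space_of_primes_zariski_diff: "space_of_primes R (zariski_diff R)"
proof (rule space_of_primes.intro[OF diff_ring_axioms], rule space_of_primes_axioms.intro)
  fix U assume "openin (zariski_diff R) U"
  then obtain T where T: "openin (zariski R) T" "U = T \<inter> diff_primes R"
    by (auto simp: zariski_diff_def openin_subtopology)
  then show "primeideal P R" if "P \<in> U" for P
    using that spec.prime by blast
  fix b assume "b \<in> carrier R"
  then have "openin (zariski R) {P \<in> T. b \<notin> P}"
    by (rule spec.basic_open[OF T(1)])
  moreover have "{P \<in> U. b \<notin> P} = {P \<in> T. b \<notin> P} \<inter> diff_primes R"
    using T(2) by blast
  ultimately show "openin (zariski_diff R) {P \<in> U. b \<notin> P}"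
    by (auto simp: zariski_diff_def openin_subtopology)
qed

interpretation dspec: space_of_primes R "zariski_diff R"
  by (rule space_of_primes_zariski_diff)

lemma openin_zariski_primes: "openin (zariski R) (primes R)"
proof -
  have "primes R = {P \<in> primes R. \<not> carrier R \<subseteq> P}"
    using primeideal.I_notcarr ideal.Icarr
    by (fastforce simp: primes_def primeideal_def)
  then show ?thesis
    unfolding openin_zariski by blast
qed

lemma openin_zariski_diff_subset:
  assumes "openin (zariski_diff R) U"
  shows "U \<subseteq> diff_primes R" "U \<subseteq> primes R"
  using openin_subset[OF assms] by (auto simp: zariski_diff_def diff_primes_def)

lemma openin_zariski_diffI:
  assumes "openin (zariski R) W" "openin (zariski_diff R) U"
  shows "openin (zariski_diff R) (W \<inter> U)"
proof -
  have "openin (zariski_diff R) (W \<inter> diff_primes R)"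
    using assms(1) by (auto simp: zariski_diff_def openin_subtopology)
  moreover have "W \<inter> U = (W \<inter> diff_primes R) \<inter> U"
    using openin_zariski_diff_subset[OF assms(2)] by blast
  ultimately show ?thesis
    using assms(2) by (simp add: openin_Int)
qed

lemma sections_structure_sheaf:
  "openin (zariski R) V \<Longrightarrow>
    sections (structure_sheaf R) V = pointwise_diff_ring V (localization_at R) (fraction_sections R (zariski R) V)"
  "restr (structure_sheaf R) V W s = restrict s W"
  by (simp_all add: structure_sheaf_def spec.sections_fraction_sheaf spec.restr_fraction_sheaf)

text \<open>Two extensions are added or multiplied on the intersection of their domains; constants extend to
  the whole spectrum.\<close>
lemma diff_ring_neighbourhood_ring:
  assumes U: "U \<subseteq> primes R"
  shows "diff_ring (neighbourhood_ring R U)"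
proof -
  let ?O = "fraction_sections R (zariski R)"
  have ring: "diff_ring (localization_at R P)" if "P \<in> U" for P
    using spec.diff_ring_at_prime[OF openin_zariski_primes] U that by blast
  have binary: "(\<lambda>P\<in>U. f P (s P) (t P)) \<in> neighbourhood_sections R U"
    if s: "s \<in> neighbourhood_sections R U" and t: "t \<in> neighbourhood_sections R U"
      and f: "\<And>V s t. \<lbrakk>openin (zariski R) V; s \<in> ?O V; t \<in> ?O V\<rbrakk> \<Longrightarrow> (\<lambda>P\<in>V. f P (s P) (t P)) \<in> ?O V"
    for f s t
  proof -
    obtain V s' where V: "openin (zariski R) V" "U \<subseteq> V" "s' \<in> ?O V" "s = restrict s' U"
      using s by (rule neighbourhood_sectionsE)
    obtain W t' where W: "openin (zariski R) W" "U \<subseteq> W" "t' \<in> ?O W" "t = restrict t' U"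
      using t by (rule neighbourhood_sectionsE)
    have VW: "openin (zariski R) (V \<inter> W)"
      using V W by blast
    let ?r = "\<lambda>P\<in>V \<inter> W. f P (restrict s' (V \<inter> W) P) (restrict t' (V \<inter> W) P)"
    have "restrict ?r U \<in> neighbourhood_sections R U"
      using V W VW by (intro neighbourhood_sectionsI[OF VW] f spec.restrict_fraction_sections[OF VW]) auto
    moreover have "restrict ?r U = (\<lambda>P\<in>U. f P (s P) (t P))"
      using V W by (intro extensionalityI[of _ U]) auto
    ultimately show ?thesis
      by simp
  qed
  have unary: "(\<lambda>P\<in>U. f P (s P)) \<in> neighbourhood_sections R U"
    if s: "s \<in> neighbourhood_sections R U"
      and f: "\<And>V s. \<lbrakk>openin (zariski R) V; s \<in> ?O V\<rbrakk> \<Longrightarrow> (\<lambda>P\<in>V. f P (s P)) \<in> ?O V" for f s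
    by (rule binary[OF s s, where f = "\<lambda>P x y. f P x"]) (rule f)
  have const: "(\<lambda>P\<in>U. c P) \<in> neighbourhood_sections R U" if "(\<lambda>P\<in>primes R. c P) \<in> ?O (primes R)" for c
  proof -
    have "restrict (\<lambda>P\<in>primes R. c P) U \<in> neighbourhood_sections R U"
      by (rule neighbourhood_sectionsI[OF openin_zariski_primes U that])
    moreover have "restrict (\<lambda>P\<in>primes R. c P) U = (\<lambda>P\<in>U. c P)"
      using U by (intro extensionalityI[of _ U]) auto
    ultimately show ?thesis
      by simp
  qed
  have sub: "neighbourhood_sections R U \<subseteq> (\<Pi>\<^sub>E P\<in>U. carrier (localization_at R P))"
  proof
    fix t assume "t \<in> neighbourhood_sections R U"
    then obtain V s where V: "openin (zariski R) V" "U \<subseteq> V" "s \<in> ?O V" "t = restrict s U"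
      by (rule neighbourhood_sectionsE)
    then show "t \<in> (\<Pi>\<^sub>E P\<in>U. carrier (localization_at R P))"
      using spec.fraction_sections_subset[OF V(1)] by (auto simp: PiE_iff subset_iff)
  qed
  note closed = spec.fraction_sections_closed
  show ?thesis
  proof (rule diff_ring_pointwise[OF ring sub const[OF closed(1)] const[OF closed(2)]])
    fix s assume s: "s \<in> neighbourhood_sections R U"
    show "(\<lambda>P\<in>U. \<ominus>\<^bsub>localization_at R P\<^esub> s P) \<in> neighbourhood_sections R U"
      by (rule unary[OF s, where f = "\<lambda>P x. \<ominus>\<^bsub>localization_at R P\<^esub> x"]) (rule closed(5))
    show "(\<lambda>P\<in>U. der (localization_at R P) (s P)) \<in> neighbourhood_sections R U"
      by (rule unary[OF s, where f = "\<lambda>P. der (localization_at R P)"]) (rule closed(6))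
    fix t assume t: "t \<in> neighbourhood_sections R U"
    show "(\<lambda>P\<in>U. s P \<otimes>\<^bsub>localization_at R P\<^esub> t P) \<in> neighbourhood_sections R U"
      by (rule binary[OF s t, where f = "\<lambda>P x y. x \<otimes>\<^bsub>localization_at R P\<^esub> y"]) (rule closed(3))
    show "(\<lambda>P\<in>U. s P \<oplus>\<^bsub>localization_at R P\<^esub> t P) \<in> neighbourhood_sections R U"
      by (rule binary[OF s t, where f = "\<lambda>P x y. x \<oplus>\<^bsub>localization_at R P\<^esub> y"]) (rule closed(4))
  qed (assumption | rule openin_zariski_primes)+
qed

text \<open>Elements of the direct limit over the neighbourhoods of \<open>U\<close> may be regarded as functions on \<open>U\<close>.
  If two sections agree at the points of \<open>U\<close>, then by \<open>eq_near\<close> the open set on which they agree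
  is a neighbourhood of \<open>U\<close>.\<close>
lemma neighbourhood_cocone:
  assumes U: "U \<subseteq> primes R"
  shows "direct_limit_cocone (zariski R) (structure_sheaf R) (neighbourhood_ring R U)
    (neighbourhoods R U) (\<lambda>V s. restrict s U)"
proof -
  interpret O: diff_ring_sheaf "zariski R" "structure_sheaf R"
    unfolding structure_sheaf_def by (rule spec.diff_ring_sheaf_fraction_sheaf)
  interpret K: diff_ring "neighbourhood_ring R U"
    by (rule diff_ring_neighbourhood_ring[OF U])
  note S = sections_structure_sheaf
  show ?thesis
  proof (unfold_locales, goal_cases)
    \<comment> \<open>Restriction to \<open>U\<close> respects the pointwise operations.\<close>
    case (4 V)
    then show ?case
      by (auto simp: S diff_ring_hom_def ring_hom_def fun_eq_iff neighbourhood_sectionsI)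
  next
    \<comment> \<open>Every element of the ring of functions is attained, by its definition.\<close>
    case (6 k)
    then obtain V s where "openin (zariski R) V" "U \<subseteq> V" "s \<in> fraction_sections R (zariski R) V"
      "k = restrict s U"
      by (auto elim: neighbourhood_sectionsE)
    then show ?case
      by (intro bexI[of _ V] bexI[of _ s]) (simp_all add: S)
  next
    \<comment> \<open>Sections that agree at the points of \<open>U\<close> agree on a neighbourhood of \<open>U\<close>.\<close>
    case (7 V V' s s')
    then have V: "openin (zariski R) V" "U \<subseteq> V" "s \<in> fraction_sections R (zariski R) V"
      and V': "openin (zariski R) V'" "U \<subseteq> V'" "s' \<in> fraction_sections R (zariski R) V'"
      and eq: "restrict s U = restrict s' U"
      by (auto simp: S)
    let ?W = "\<Union>{W. openin (zariski R) W \<and> W \<subseteq> V \<inter> V' \<and> (\<forall>Q\<in>W. s Q = s' Q)}"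
    have "P \<in> ?W" if P: "P \<in> U" for P
    proof -
      have "s P = s' P"
        using fun_cong[OF eq, of P] P by simp
      then show ?thesis
        using spec.eq_near[OF V(3) V'(3), of P] P V(2) V'(2) by blast
    qed
    then have "?W \<in> neighbourhoods R U"
      by auto
    moreover have "restrict s ?W = restrict s' ?W"
      by (intro restrict_ext) auto
    ultimately show ?case
      by (intro bexI[of _ ?W]) (auto simp: S)
  qed (use openin_zariski_primes U in \<open>auto simp: S fun_eq_iff neighbourhood_sections_def\<close>)
qed

lemma sections_trace_presheaf:
  "sections (trace_presheaf R) U = direct_limit (structure_sheaf R) (neighbourhoods R U)"
  by (simp add: presheaf_inverse_image_def)

lemma trace_transport:
  assumes "U \<subseteq> primes R"
  shows "diff_ring_transport (sections (trace_presheaf R) U) (neighbourhood_ring R U) (germ_values U)"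
  unfolding sections_trace_presheaf germ_values_def
  by (rule direct_limit_cocone.direct_limit_transport[OF neighbourhood_cocone[OF assms]])

text \<open>Under this identification, the restriction maps of the inverse image presheaf are restrictions of
  functions.\<close>
lemma germ_values_restr:
  assumes U: "U \<subseteq> primes R" and U': "U' \<subseteq> U" and \<xi>: "\<xi> \<in> carrier (sections (trace_presheaf R) U)"
  shows "restr (trace_presheaf R) U U' \<xi> \<in> carrier (sections (trace_presheaf R) U')"
    and "germ_values U' (restr (trace_presheaf R) U U' \<xi>) = restrict (germ_values U \<xi>) U'"
proof -
  have sub: "U' \<subseteq> primes R"
    using U U' by blast
  let ?N = "neighbourhoods R U" and ?N' = "neighbourhoods R U'" and ?O = "structure_sheaf R"
  interpret L: direct_limit_cocone "zariski R" ?O "neighbourhood_ring R U" ?N "\<lambda>V s. restrict s U"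
    by (rule neighbourhood_cocone[OF U])
  interpret L': direct_limit_cocone "zariski R" ?O "neighbourhood_ring R U'" ?N' "\<lambda>V s. restrict s U'"
    by (rule neighbourhood_cocone[OF sub])
  obtain V s where V: "V \<in> ?N" "s \<in> carrier (sections ?O V)" and \<xi>_eq: "\<xi> = germ ?O ?N V s"
    using \<xi> by (auto simp: sections_trace_presheaf direct_limit_def)
  have V': "V \<in> ?N'"
    using V U' by auto
  have "germ ?O ?N' W t = germ ?O ?N' V s" if "(W, t) \<in> germ ?O ?N V s" for W t
  proof -
    have W: "W \<in> ?N" "t \<in> carrier (sections ?O W)" "restrict t U = restrict s U"
      using that by (auto simp: L.germ_eq_representatives[OF V] L.representatives_def)
    then have "restrict t U' = restrict s U'"
      using U' by (metis inf.absorb_iff2 restrict_restrict)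
    moreover have "W \<in> ?N'"
      using W U' by auto
    ultimately show ?thesis
      using L'.germ_eq_representatives W(2) V' V(2) by simp
  qed
  moreover have "(V, s) \<in> germ ?O ?N V s"
    using V by (simp add: L.germ_eq_representatives[OF V] L.representatives_def)
  ultimately have restr: "restr (trace_presheaf R) U U' \<xi> = germ ?O ?N' V s"
    unfolding \<xi>_eq presheaf_inverse_image_def presheaf.simps by (intro UN_pair_eq)
  show "restr (trace_presheaf R) U U' \<xi> \<in> carrier (sections (trace_presheaf R) U')"
    unfolding restr sections_trace_presheaf by (rule L'.germ_closed[OF V' V(2)])
  have "germ_values U' (restr (trace_presheaf R) U U' \<xi>) = restrict s U'"
    unfolding restr germ_values_def by (rule L'.limit_value_germ[OF V' V(2)])
  also have "\<dots> = restrict (restrict s U) U'"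
    using U' by (simp add: Int_absorb1)
  also have "restrict s U = germ_values U \<xi>"
    unfolding \<xi>_eq germ_values_def by (rule L.limit_value_germ[OF V, symmetric])
  finally show "germ_values U' (restr (trace_presheaf R) U U' \<xi>) = restrict (germ_values U \<xi>) U'" .
qed

lemma diff_ring_presheaf_trace: "diff_ring_presheaf (zariski_diff R) (trace_presheaf R)"
proof (rule presheaf_transport)
  let ?G = "\<lparr>sections = neighbourhood_ring R, restr = \<lambda>U V s. restrict s V\<rparr>"
  show "diff_ring_presheaf (zariski_diff R) ?G"
  proof (rule pointwise_presheaf)
    fix U assume U: "openin (zariski_diff R) U"
    show "diff_ring (neighbourhood_ring R U)"
      by (rule diff_ring_neighbourhood_ring[OF openin_zariski_diff_subset(2)[OF U]])
    show "neighbourhood_sections R U \<subseteq> extensional U"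
      by (auto simp: neighbourhood_sections_def)
    show "restrict s V \<in> neighbourhood_sections R V"
      if V: "V \<subseteq> U" and s: "s \<in> neighbourhood_sections R U" for V s
    proof -
      obtain W t where W: "openin (zariski R) W" "U \<subseteq> W" "t \<in> fraction_sections R (zariski R) W" "s = restrict t U"
        using s by (rule neighbourhood_sectionsE)
      have "restrict t V \<in> neighbourhood_sections R V"
        using W V by (intro neighbourhood_sectionsI) auto
      then show ?thesis
        using W(4) V by (simp add: Int_absorb1)
    qed
  qed simp_all
  fix U assume U: "openin (zariski_diff R) U"
  show "diff_ring_transport (sections (trace_presheaf R) U) (sections ?G U) (germ_values U)"
    using trace_transport[OF openin_zariski_diff_subset(2)[OF U]] by simp
  show "restr (trace_presheaf R) U V \<xi> \<in> carrier (sections (trace_presheaf R) V) \<and>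
      germ_values V (restr (trace_presheaf R) U V \<xi>) = restr ?G U V (germ_values U \<xi>)"
    if "V \<subseteq> U" "\<xi> \<in> carrier (sections (trace_presheaf R) U)" for V \<xi>
    using germ_values_restr[OF openin_zariski_diff_subset(2)[OF U] that] by simp
qed

lemma germ_values_surj:
  assumes "U \<subseteq> primes R" "openin (zariski R) V" "U \<subseteq> V" "s \<in> fraction_sections R (zariski R) V"
  obtains \<xi> where "\<xi> \<in> carrier (sections (trace_presheaf R) U)" "germ_values U \<xi> = restrict s U"
proof (rule diff_ring_transport.surjE[OF trace_transport[OF assms(1)]])
  show "restrict s U \<in> carrier (neighbourhood_ring R U)"
    using neighbourhood_sectionsI[OF assms(2-4)] by simp
qed (rule that)

lemma germ_valuesE:
  assumes "U \<subseteq> primes R" "\<xi> \<in> carrier (sections (trace_presheaf R) U)"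
  obtains V s where "openin (zariski R) V" "U \<subseteq> V" "s \<in> fraction_sections R (zariski R) V"
    "germ_values U \<xi> = restrict s U"
  using diff_ring_transport.closed[OF trace_transport[OF assms(1)] assms(2)]
  by (auto elim: neighbourhood_sectionsE)

section \<open>Stalks at differential primes\<close>

text \<open>Every element \<open>a/b\<close> of the local ring at \<open>q\<close> is the value of the section \<open>a/b\<close> over the set of primes
  not containing \<open>b\<close>. Injectivity is \<open>eq_near\<close> again: representatives with the same value at \<open>q\<close> agree on
  a Zariski open \<open>W\<close> around \<open>q\<close>, hence as functions on the trace of \<open>W\<close>.\<close>
lemma stalk_cocone:
  assumes q: "q \<in> diff_primes R"
  shows "direct_limit_cocone (zariski_diff R) (trace_presheaf R) (localization_at R q)
    (nhds_of (zariski_diff R) q) (\<lambda>U \<xi>. germ_values U \<xi> q)"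
proof -
  have qp: "q \<in> primes R" "primeideal q R"
    using q by (auto simp: diff_primes_def primes_def)
  interpret L: diff_ring_presheaf "zariski_diff R" "trace_presheaf R"
    by (rule diff_ring_presheaf_trace)
  interpret K: diff_ring "localization_at R q"
    by (rule spec.diff_ring_at_prime[OF openin_zariski_primes qp(1)])
  have Y: "openin (zariski_diff R) (diff_primes R)"
    using openin_zariski_primes by (auto simp: zariski_diff_def openin_subtopology diff_primes_def)
  show ?thesis
  proof (unfold_locales, goal_cases)
    \<comment> \<open>The point \<open>q\<close> has a neighbourhood, namely the whole space.\<close>
    case 2
    show ?case using Y q by blast
  next
    \<comment> \<open>Evaluation at \<open>q\<close> is a homomorphism.\<close>
    case (4 U)
    then have U: "openin (zariski_diff R) U" "q \<in> U" by auto
    interpret U: diff_ring_transport "sections (trace_presheaf R) U" "neighbourhood_ring R U" "germ_values U"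
      by (rule trace_transport[OF openin_zariski_diff_subset(2)[OF U(1)]])
    have "germ_values U \<xi> q \<in> carrier (localization_at R q)" if \<xi>: "\<xi> \<in> carrier (sections (trace_presheaf R) U)" for \<xi>
    proof -
      obtain V s where "openin (zariski R) V" "U \<subseteq> V" "s \<in> fraction_sections R (zariski R) V"
        "germ_values U \<xi> = restrict s U"
        using openin_zariski_diff_subset(2)[OF U(1)] \<xi> by (rule germ_valuesE)
      then show ?thesis
        using spec.fraction_sections_subset[of V] U(2) by (auto simp: PiE_iff subset_iff)
    qed
    then show ?case
      using U(2) by (auto simp: diff_ring_hom_def ring_hom_def U.one U.mult U.add U.der)
  next
    case (5 U V \<xi>)
    then show ?case
      using germ_values_restr(2)[OF openin_zariski_diff_subset(2)] by auto
  next
    \<comment> \<open>Evaluation at \<open>q\<close> attains every fraction.\<close>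
    case (6 k)
    then obtain a b where k: "k = local_frac R q a b" "a \<in> carrier R" "b \<in> carrier R" "b \<notin> q"
      using localized_diff_ring.carrier_localization[OF localized_at_prime[OF qp(2)]]
      by (auto simp: localization_at_def)
    let ?V = "{P \<in> primes R. b \<notin> P}"
    let ?U = "?V \<inter> diff_primes R" and ?s = "\<lambda>P\<in>?V. local_frac R P a b"
    have V: "openin (zariski R) ?V"
      by (rule spec.basic_open[OF openin_zariski_primes k(3)])
    have s: "?s \<in> fraction_sections R (zariski R) ?V"
      using V k by (intro spec.constant_fraction_mem) auto
    obtain \<xi> where \<xi>: "\<xi> \<in> carrier (sections (trace_presheaf R) ?U)" "germ_values ?U \<xi> = restrict ?s ?U"
      by (rule germ_values_surj[OF _ V _ s, of ?U]) auto
    have "?U \<in> nhds_of (zariski_diff R) q"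
      using openin_zariski_diffI[OF V Y] q qp k(4) by simp
    moreover have "germ_values ?U \<xi> q = k"
      using \<xi>(2) q qp k by simp
    ultimately show ?case
      using \<xi>(1) by blast
  next
    \<comment> \<open>Evaluation at \<open>q\<close> is injective in the limit.\<close>
    case (7 U U' \<xi> \<xi>')
    then have U: "openin (zariski_diff R) U" "q \<in> U" and U': "openin (zariski_diff R) U'" "q \<in> U'"
      by auto
    note sub = openin_zariski_diff_subset(2)[OF U(1)] and sub' = openin_zariski_diff_subset(2)[OF U'(1)]
    obtain V s where V: "openin (zariski R) V" "U \<subseteq> V" "s \<in> fraction_sections R (zariski R) V"
      "germ_values U \<xi> = restrict s U"
      using sub 7(3) by (rule germ_valuesE)
    obtain V' s' where V': "openin (zariski R) V'" "U' \<subseteq> V'" "s' \<in> fraction_sections R (zariski R) V'"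
      "germ_values U' \<xi>' = restrict s' U'"
      using sub' 7(4) by (rule germ_valuesE)
    have "s q = s' q"
      using 7(5) V(4) V'(4) U(2) U'(2) by simp
    moreover have "q \<in> V" "q \<in> V'"
      using U(2) U'(2) V(2) V'(2) by auto
    ultimately have "\<exists>W. openin (zariski R) W \<and> q \<in> W \<and> W \<subseteq> V \<inter> V' \<and> (\<forall>Q\<in>W. s Q = s' Q)"
      by (intro spec.eq_near[OF V(3) V'(3)])
    then obtain W where W: "openin (zariski R) W" "q \<in> W" "\<And>Q. Q \<in> W \<Longrightarrow> s Q = s' Q"
      by auto
    let ?W = "W \<inter> (U \<inter> U')"
    have openW: "openin (zariski_diff R) ?W"
      by (rule openin_zariski_diffI[OF W(1) openin_Int[OF U(1) U'(1)]])
    interpret W: diff_ring_transport "sections (trace_presheaf R) ?W" "neighbourhood_ring R ?W" "germ_values ?W"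
      by (rule trace_transport[OF openin_zariski_diff_subset(2)[OF openW]])
    have WU: "?W \<subseteq> U" "?W \<subseteq> U'" by auto
    note r = germ_values_restr[OF sub WU(1) 7(3)] and r' = germ_values_restr[OF sub' WU(2) 7(4)]
    have "germ_values ?W (restr (trace_presheaf R) U ?W \<xi>) = germ_values ?W (restr (trace_presheaf R) U' ?W \<xi>')"
      unfolding r(2) r'(2) V(4) V'(4) using W(3) by (intro extensionalityI[of _ ?W]) auto
    then have "restr (trace_presheaf R) U ?W \<xi> = restr (trace_presheaf R) U' ?W \<xi>'"
      by (rule W.eqI[OF _ r(1) r'(1)])
    with openW W(2) U(2) U'(2) show ?case
      by (intro bexI[of _ ?W]) auto
  qed auto
qed

definition stalk_value :: "'a set \<Rightarrow> ('a set set \<times> ('a set set \<times> ('a set \<Rightarrow> ('a \<times> 'a) set)) set) set \<Rightarrow> ('a \<times> 'a) set" where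
  "stalk_value q = limit_value (\<lambda>U \<xi>. germ_values U \<xi> q)"

lemma stalk_transport:
  "q \<in> diff_primes R \<Longrightarrow>
    diff_ring_transport (stalk (zariski_diff R) (trace_presheaf R) q) (localization_at R q) (stalk_value q)"
  unfolding stalk_def stalk_value_def
  by (rule direct_limit_cocone.direct_limit_transport[OF stalk_cocone])

lemma stalk_value_germ:
  assumes "openin (zariski_diff R) V" "\<tau> \<in> carrier (sections (trace_presheaf R) V)" "q \<in> V"
  shows "stalk_value q (germ (trace_presheaf R) (nhds_of (zariski_diff R) q) V \<tau>) = germ_values V \<tau> q"
    and "germ (trace_presheaf R) (nhds_of (zariski_diff R) q) V \<tau> \<in> carrier (stalk (zariski_diff R) (trace_presheaf R) q)"
proof -
  have q: "q \<in> diff_primes R"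
    using assms openin_zariski_diff_subset by blast
  show "stalk_value q (germ (trace_presheaf R) (nhds_of (zariski_diff R) q) V \<tau>) = germ_values V \<tau> q"
    unfolding stalk_value_def using assms
    by (intro direct_limit_cocone.limit_value_germ[OF stalk_cocone[OF q]]) auto
  show "germ (trace_presheaf R) (nhds_of (zariski_diff R) q) V \<tau> \<in> carrier (stalk (zariski_diff R) (trace_presheaf R) q)"
    unfolding stalk_def using assms
    by (intro direct_limit_cocone.germ_closed[OF stalk_cocone[OF q]]) auto
qed

text \<open>The comparison of the two local conditions. A germ of the inverse image presheaf comes from a section
  of the structure sheaf over some Zariski open set, and the latter is locally a fraction. Conversely, a
  local fraction \<open>a/b\<close> on \<open>V\<close> extends to the Zariski open set where \<open>b\<close> does not vanish.\<close>
lemma locally_germ_iff_locally_fraction: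
  assumes U: "openin (zariski_diff R) U"
    and s: "s \<in> (\<Pi>\<^sub>E q\<in>U. carrier (stalk (zariski_diff R) (trace_presheaf R) q))"
  shows "(\<forall>p\<in>U. \<exists>V. openin (zariski_diff R) V \<and> p \<in> V \<and> V \<subseteq> U \<and>
      (\<exists>t\<in>carrier (sections (trace_presheaf R) V).
        \<forall>q\<in>V. s q = germ (trace_presheaf R) (nhds_of (zariski_diff R) q) V t)) \<longleftrightarrow>
    (\<lambda>q\<in>U. stalk_value q (s q)) \<in> fraction_sections R (zariski_diff R) U"
    (is "?lhs \<longleftrightarrow> ?rhs")
proof
  assume ?lhs
  show ?rhs
  proof (rule dspec.fraction_sectionsI)
    fix p assume p: "p \<in> U"
    obtain V where V: "openin (zariski_diff R) V" "p \<in> V" "V \<subseteq> U"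
      and "\<exists>t\<in>carrier (sections (trace_presheaf R) V).
        \<forall>q\<in>V. s q = germ (trace_presheaf R) (nhds_of (zariski_diff R) q) V t"
      using bspec[OF \<open>?lhs\<close> p] by (elim exE conjE)
    then obtain t where t: "t \<in> carrier (sections (trace_presheaf R) V)"
      and germ: "\<And>q. q \<in> V \<Longrightarrow> s q = germ (trace_presheaf R) (nhds_of (zariski_diff R) q) V t"
      by (elim bexE) (rule that, assumption, erule bspec)
    obtain V' r where V': "openin (zariski R) V'" "V \<subseteq> V'" "r \<in> fraction_sections R (zariski R) V'"
      "germ_values V t = restrict r V"
      using openin_zariski_diff_subset(2)[OF V(1)] t by (rule germ_valuesE)
    obtain W a b where W: "openin (zariski R) W" "p \<in> W" "fraction_on R W r a b"
      using V'(2,3) V(2) by (meson fraction_sectionsE subsetD)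
    have "(\<lambda>q\<in>U. stalk_value q (s q)) q = r q" if "q \<in> W \<inter> V" for q
      using that V(3) stalk_value_germ(1)[OF V(1) t, of q] germ[of q] V'(4) by auto
    then show "\<exists>V t. openin (zariski_diff R) V \<and> p \<in> V \<and> V \<subseteq> U \<and>
        (\<forall>q\<in>V. (\<lambda>q\<in>U. stalk_value q (s q)) q = t q) \<and> (\<exists>a b. fraction_on R V t a b)"
      using W V openin_zariski_diffI[OF W(1) V(1)]
      by (intro exI[of _ "W \<inter> V"] exI[of _ r]) (auto intro: fraction_on_mono)
  qed simp
next
  assume ?rhs
  show ?lhs
  proof
    fix p assume "p \<in> U"
    with \<open>?rhs\<close> obtain V a b where V: "openin (zariski_diff R) V" "p \<in> V" "V \<subseteq> U"
      and ab: "fraction_on R V (\<lambda>q\<in>U. stalk_value q (s q)) a b"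
      by (rule fraction_sectionsE)
    have "stalk_value q (s q) = local_frac R q a b" if "q \<in> V" for q
    proof -
      have "(\<lambda>q\<in>U. stalk_value q (s q)) q = local_frac R q a b"
        using ab that unfolding fraction_on_def by blast
      moreover have "q \<in> U"
        using that V(3) by blast
      ultimately show ?thesis
        by simp
    qed
    moreover have "a \<in> carrier R" "b \<in> carrier R" "\<And>q. q \<in> V \<Longrightarrow> b \<notin> q"
      using ab by (simp_all add: fraction_on_def)
    ultimately have ab': "a \<in> carrier R" "b \<in> carrier R" "\<And>q. q \<in> V \<Longrightarrow> b \<notin> q"
      "\<And>q. q \<in> V \<Longrightarrow> stalk_value q (s q) = local_frac R q a b"
      by simp_all
    let ?D = "{P \<in> primes R. b \<notin> P}"
    let ?r = "\<lambda>P\<in>?D. local_frac R P a b"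
    have D: "openin (zariski R) ?D"
      by (rule spec.basic_open[OF openin_zariski_primes ab'(2)])
    have r: "?r \<in> fraction_sections R (zariski R) ?D"
      using D ab' by (intro spec.constant_fraction_mem) auto
    note sub = openin_zariski_diff_subset(2)[OF V(1)]
    have VD: "V \<subseteq> ?D"
      using sub ab'(3) by auto
    obtain t where t: "t \<in> carrier (sections (trace_presheaf R) V)" "germ_values V t = restrict ?r V"
      by (rule germ_values_surj[OF sub D VD r])
    have "s q = germ (trace_presheaf R) (nhds_of (zariski_diff R) q) V t" if q: "q \<in> V" for q
    proof (rule diff_ring_transport.eqI[OF stalk_transport])
      show "q \<in> diff_primes R"
        using q V(1) openin_zariski_diff_subset by blast
      show "s q \<in> carrier (stalk (zariski_diff R) (trace_presheaf R) q)"
        using s q V(3) by (auto simp: PiE_iff)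
      show "germ (trace_presheaf R) (nhds_of (zariski_diff R) q) V t \<in> carrier (stalk (zariski_diff R) (trace_presheaf R) q)"
        by (rule stalk_value_germ(2)[OF V(1) t(1) q])
      have "q \<in> ?D" using q VD by blast
      then show "stalk_value q (s q) = stalk_value q (germ (trace_presheaf R) (nhds_of (zariski_diff R) q) V t)"
        unfolding stalk_value_germ(1)[OF V(1) t(1) q] t(2) using q ab'(4) by simp
    qed
    with V t(1) show "\<exists>V. openin (zariski_diff R) V \<and> p \<in> V \<and> V \<subseteq> U \<and>
      (\<exists>t\<in>carrier (sections (trace_presheaf R) V).
        \<forall>q\<in>V. s q = germ (trace_presheaf R) (nhds_of (zariski_diff R) q) V t)"
      by blast
  qed
qed

text \<open>A section of Keigher's sheaf restricts to a section because its image in Kovacic's sheaf does.\<close>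
lemma keigher_isomorphic_kovacic:
  "isomorphic_diff_ring_sheaves (zariski_diff R) (keigher_sheaf R) (kovacic_sheaf R)"
proof (rule sheaf_transport)
  let ?Kei = "keigher_sheaf R" and ?Kov = "kovacic_sheaf R"
  let ?\<phi> = "\<lambda>U s. \<lambda>q\<in>U. stalk_value q (s q)"
  show "diff_ring_sheaf (zariski_diff R) ?Kov"
    unfolding kovacic_sheaf_def by (rule dspec.diff_ring_sheaf_fraction_sheaf)
  have Kei: "keigher_sheaf R = sheafify (zariski_diff R) (trace_presheaf R)"
    by (simp add: keigher_sheaf_def inverse_image_def zariski_diff_def)
  fix U assume U: "openin (zariski_diff R) U"
  have tr: "diff_ring_transport (sections ?Kei U) (sections ?Kov U) (?\<phi> U)" if U: "openin (zariski_diff R) U" for U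
    unfolding Kei kovacic_sheaf_def dspec.sections_fraction_sheaf[OF U] sheafify_def presheaf.simps
  proof (rule pointwise_transport)
    show "diff_ring_transport (stalk (zariski_diff R) (trace_presheaf R) q) (localization_at R q) (stalk_value q)"
      if "q \<in> U" for q
      using that U openin_zariski_diff_subset by (intro stalk_transport) blast
    show "fraction_sections R (zariski_diff R) U \<subseteq> (\<Pi>\<^sub>E q\<in>U. carrier (localization_at R q))"
      by (rule dspec.fraction_sections_subset[OF U])
    show "diff_ring (pointwise_diff_ring U (localization_at R) (fraction_sections R (zariski_diff R) U))"
      by (rule dspec.diff_ring_fraction_sections[OF U])
  qed (use locally_germ_iff_locally_fraction[OF U] in blast)
  show "diff_ring_transport (sections ?Kei U) (sections ?Kov U) (?\<phi> U)"
    by (rule tr[OF U])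
  fix V s assume V: "openin (zariski_diff R) V" "V \<subseteq> U" and s: "s \<in> carrier (sections ?Kei U)"
  have eq: "?\<phi> V (restr ?Kei U V s) = restr ?Kov U V (?\<phi> U s)"
    using V(2) by (intro extensionalityI[of _ V]) (auto simp: Kei sheafify_def kovacic_sheaf_def fraction_sheaf_def)
  moreover have "restr ?Kei U V s \<in> carrier (sections ?Kei V)"
  proof -
    have s': "s \<in> (\<Pi>\<^sub>E q\<in>U. carrier (stalk (zariski_diff R) (trace_presheaf R) q))"
      using s by (simp add: Kei sheafify_def)
    then have rs: "restrict s V \<in> (\<Pi>\<^sub>E q\<in>V. carrier (stalk (zariski_diff R) (trace_presheaf R) q))"
      using V(2) by (auto simp: PiE_iff)
    have "?\<phi> U s \<in> fraction_sections R (zariski_diff R) U"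
      using diff_ring_transport.closed[OF tr[OF U] s]
      by (simp add: kovacic_sheaf_def dspec.sections_fraction_sheaf[OF U])
    then have "restrict (?\<phi> U s) V \<in> fraction_sections R (zariski_diff R) V"
      by (rule dspec.restrict_fraction_sections[OF V])
    moreover have "restrict (?\<phi> U s) V = ?\<phi> V (restrict s V)"
      using V(2) by (intro extensionalityI[of _ V]) auto
    ultimately have "?\<phi> V (restrict s V) \<in> fraction_sections R (zariski_diff R) V"
      by simp
    with locally_germ_iff_locally_fraction[OF V(1) rs] rs show ?thesis
      by (simp add: Kei sheafify_def)
  qed
  ultimately show "restr ?Kei U V s \<in> carrier (sections ?Kei V) \<and>
      ?\<phi> V (restr ?Kei U V s) = restr ?Kov U V (?\<phi> U s)"
    by blast
qed

end

theorem proposition5p2: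
  fixes A :: "('a, 'm) diff_ring_scheme"
  assumes "diff_ring A"
  shows "isomorphic_diff_ring_sheaves (zariski_diff A) (keigher_sheaf A) (kovacic_sheaf A)"
  using assms by (rule diff_ring.keigher_isomorphic_kovacic)

end
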